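(* Consider the system of Hammerstein integral equations, for $t\in[0,1]$, $$u(t)=\int_0^1 k_1(t,s)g_1(s)f_1(s,u(s),v(s))\,ds,\qquad v(t)=\int_0^1 k_2(t,s)g_2(s)f_2(s,u(s),v(s))\,ds,$$ under the standing assumptions listed in the context, with the conditions $(\mathrm I^1_{\rho_1,\rho_2})$, $(\mathrm I^0_{\rho_1,\rho_2})$, $(\mathrm I^0_{\rho_1,\rho_2})^\star$ defined there. The system has at least one nontrivial solution in $K$ if one of the following holds. $(S_1)$ For $i=1,2$ there exist $\rho_i,r_i\in(0,\infty)$ with $\rho_i/c_i<r_i$ such that $(\mathrm I^0_{\rho_1,\rho_2})$ [or $(\mathrm I^0_{\rho_1,\rho_2})^\star$] and $(\mathrm I^1_{r_1,r_2})$ hold. $(S_2)$ For $i=1,2$ there exist $\rho_i,r_i\in(0,\infty)$ with $\rho_i<r_i$ such that $(\mathrm I^1_{\rho_1,\rho_2})$ and $(\mathrm I^0_{r_1,r_2})$ hold. The system has at least two nontrivial solutions in $K$ if one of the following holds. $(S_3)$ For $i=1,2$ there exist $\rho_i,r_i,s_i\in(0,\infty)$ with $\rho_i/c_i<r_i<s_i$ such that $(\mathrm I^0_{\rho_1,\rho_2})$ [or $(\mathrm I^0_{\rho_1,\rho_2})^\star$], $(\mathrm I^1_{r_1,r_2})$ and $(\mathrm I^0_{s_1,s_2})$ hold. $(S_4)$ For $i=1,2$ there exist $\rho_i,r_i,s_i\in(0,\infty)$ with $\rho_i<r_i$ and $r_i/c_i<s_i$ such that $(\mathrm I^1_{\rho_1,\rho_2})$,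 $(\mathrm I^0_{r_1,r_2})$ and $(\mathrm I^1_{s_1,s_2})$ hold. The system has at least three nontrivial solutions in $K$ if one of the following holds. $(S_5)$ For $i=1,2$ there exist $\rho_i,r_i,s_i,\sigma_i\in(0,\infty)$ with $\rho_i/c_i<r_i<s_i$ and $s_i/c_i<\sigma_i$ such that $(\mathrm I^0_{\rho_1,\rho_2})$ [or $(\mathrm I^0_{\rho_1,\rho_2})^\star$], $(\mathrm I^1_{r_1,r_2})$, $(\mathrm I^0_{s_1,s_2})$ and $(\mathrm I^1_{\sigma_1,\sigma_2})$ hold. $(S_6)$ For $i=1,2$ there exist $\rho_i,r_i,s_i,\sigma_i\in(0,\infty)$ with $\rho_i<r_i$ and $r_i/c_i<s_i<\sigma_i$ such that $(\mathrm I^1_{\rho_1,\rho_2})$, $(\mathrm I^0_{r_1,r_2})$, $(\mathrm I^1_{s_1,s_2})$ and $(\mathrm I^0_{\sigma_1,\sigma_2})$ hold.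
   Context: Standing assumptions, for $i=1,2$: - $f_i:[0,1]\times\mathbb R\times\mathbb R\to[0,\infty)$ satisfies Carathéodory conditions: $f_i(\cdot,u,v)$ is measurable for each $(u,v)$, $f_i(t,\cdot,\cdot)$ is continuous for a.e. $t$, and for each $r>0$ there is $\phi_{i,r}\in L^\infty[0,1]$ with $f_i(t,u,v)\le\phi_{i,r}(t)$ for $u,v\in[-r,r]$ and a.e. $t\in[0,1]$. - $k_i:[0,1]\times[0,1]\to\mathbb R$ is measurable, and for every $\tau\in[0,1]$, $\lim_{t\to\tau}|k_i(t,s)-k_i(\tau,s)|=0$ for a.e. $s\in[0,1]$. - There exist a subinterval $[a_i,b_i]\subseteq[0,1]$, $\Phi_i\in L^\infty[0,1]$ and $c_i\in(0,1]$ with $|k_i(t,s)|\le\Phi_i(s)$ for $t\in[0,1]$ and a.e. $s\in[0,1]$, and $k_i(t,s)\ge c_i\Phi_i(s)$ for $t\in[a_i,b_i]$ and a.e. $s\in[0,1]$. - $g_i$ is measurable, $g_i\Phi_i\in L^1[0,1]$, $g_i\ge0$ a.e., and $\int_{a_i}^{b_i}\Phi_i(s)g_i(s)\,ds>0$. $C[0,1]\times C[0,1]$ has the norm $\|(u,v)\|=\max\{\|u\|_\infty,\|v\|_\infty\}$. Let $\tilde K_i=\{w\in C[0,1]:\min_{t\in[a_i,b_i]}w(t)\ge c_i\|w\|_\infty\}$ and $K=\tilde K_1\times\tilde K_2$. A nontrivial solution of the system is a solution $(u,v)\in K$ with $\|(u,v)\|\ne0$. Constants: $\frac1{m_i}=\sup_{t\in[0,1]}\int_0^1|k_i(t,s)|g_i(s)\,ds$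 and $\frac1{M_i}=\inf_{t\in[a_i,b_i]}\int_{a_i}^{b_i}k_i(t,s)g_i(s)\,ds$. Conditions, for $\rho_1,\rho_2>0$: - $(\mathrm I^1_{\rho_1,\rho_2})$: for every $i=1,2$, $\sup\{f_i(t,u,v)/\rho_i:(t,u,v)\in[0,1]\times[-\rho_1,\rho_1]\times[-\rho_2,\rho_2]\}<m_i$. - $(\mathrm I^0_{\rho_1,\rho_2})$: $\inf\{f_1(t,u,v)/\rho_1:(t,u,v)\in[a_1,b_1]\times[\rho_1,\rho_1/c_1]\times[-\rho_2/c_2,\rho_2/c_2]\}>M_1$ and $\inf\{f_2(t,u,v)/\rho_2:(t,u,v)\in[a_2,b_2]\times[-\rho_1/c_1,\rho_1/c_1]\times[\rho_2,\rho_2/c_2]\}>M_2$. - $(\mathrm I^0_{\rho_1,\rho_2})^\star$: at least one of the following holds: $\inf\{f_1(t,u,v)/\rho_1:(t,u,v)\in[a_1,b_1]\times[0,\rho_1/c_1]\times[-\rho_2/c_2,\rho_2/c_2]\}>M_1$, or $\inf\{f_2(t,u,v)/\rho_2:(t,u,v)\in[a_2,b_2]\times[-\rho_1/c_1,\rho_1/c_1]\times[0,\rho_2/c_2]\}>M_2$. *)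

theory Defs
  imports "HOL-Analysis.Analysis"
begin

text \<open>
  The data of the system are families indexed by \<open>i \<in> {1, 2}\<close>; their values at other indices
  are irrelevant. Likewise, functions on \<open>[0,1]\<close> given as data are total functions whose values
  outside \<open>[0,1]\<close> are never used. Measurability and ``almost everywhere'' refer to Lebesgue measure.
\<close>

abbreviation leb01 :: "real measure" where
  "leb01 \<equiv> lebesgue_on {0..1}"

definition Linfty01 :: "(real \<Rightarrow> real) set" where
  "Linfty01 = {h. h \<in> borel_measurable leb01 \<and> (\<exists>B. AE t in leb01. \<bar>h t\<bar> \<le> B)}"

definition caratheodory :: "(real \<Rightarrow> real \<Rightarrow> real \<Rightarrow> real) \<Rightarrow> bool" where
  "caratheodory f \<longleftrightarrow>
     (\<forall>u v. (\<lambda>t. f t u v) \<in> borel_measurable leb01) \<and>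
     (AE t in leb01. continuous_on UNIV (\<lambda>(u, v). f t u v)) \<and>
     (\<forall>r>0. \<exists>\<phi>\<in>Linfty01. \<forall>u\<in>{-r..r}. \<forall>v\<in>{-r..r}. AE t in leb01. f t u v \<le> \<phi> t)"

definition standing_assumptions ::
  "(real \<Rightarrow> real \<Rightarrow> real \<Rightarrow> real) \<Rightarrow> (real \<Rightarrow> real \<Rightarrow> real) \<Rightarrow> (real \<Rightarrow> real) \<Rightarrow> (real \<Rightarrow> real)
    \<Rightarrow> real \<Rightarrow> real \<Rightarrow> real \<Rightarrow> bool" where
  "standing_assumptions f k g \<Phi> a b c \<longleftrightarrow>
     (\<forall>t\<in>{0..1}. \<forall>u v. 0 \<le> f t u v) \<and>
     caratheodory f \<and>
     (\<lambda>(t, s). k t s) \<in> borel_measurable (lebesgue_on ({0..1} \<times> {0..1})) \<and>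
     (\<forall>\<tau>\<in>{0..1}. AE s in leb01. ((\<lambda>t. \<bar>k t s - k \<tau> s\<bar>) \<longlongrightarrow> 0) (at \<tau> within {0..1})) \<and>
     0 \<le> a \<and> a \<le> b \<and> b \<le> 1 \<and>
     \<Phi> \<in> Linfty01 \<and>
     0 < c \<and> c \<le> 1 \<and>
     (\<forall>t\<in>{0..1}. AE s in leb01. \<bar>k t s\<bar> \<le> \<Phi> s) \<and>
     (\<forall>t\<in>{a..b}. AE s in leb01. k t s \<ge> c * \<Phi> s) \<and>
     g \<in> borel_measurable leb01 \<and>
     integrable leb01 (\<lambda>s. g s * \<Phi> s) \<and>
     (AE s in leb01. 0 \<le> g s) \<and>
     (LINT s|lebesgue_on {a..b}. \<Phi> s * g s) > 0"

text \<open>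
  An element of \<open>C[0,1]\<close> is represented by its unique extension to the reals that is
  \<open>undefined\<close> off \<open>[0,1]\<close>, so that equality of elements is equality on \<open>[0,1]\<close>
  and distinct solutions can be counted.
\<close>

definition C01 :: "(real \<Rightarrow> real) set" where
  "C01 = {w \<in> extensional {0..1}. continuous_on {0..1} w}"

definition supnorm01 :: "(real \<Rightarrow> real) \<Rightarrow> real" where
  "supnorm01 w = (SUP t\<in>{0..1}. \<bar>w t\<bar>)"

definition pair_norm :: "(real \<Rightarrow> real) \<times> (real \<Rightarrow> real) \<Rightarrow> real" where
  "pair_norm w = max (supnorm01 (fst w)) (supnorm01 (snd w))"

text \<open>The infimum over the nonempty compact interval \<open>[a,b]\<close> is attained, i.e. it is the minimum.\<close>

definition K_tilde :: "real \<Rightarrow> real \<Rightarrow> real \<Rightarrow> (real \<Rightarrow> real) set" where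
  "K_tilde a b c = {w \<in> C01. (INF t\<in>{a..b}. w t) \<ge> c * supnorm01 w}"

definition K_cone ::
  "(nat \<Rightarrow> real) \<Rightarrow> (nat \<Rightarrow> real) \<Rightarrow> (nat \<Rightarrow> real) \<Rightarrow> ((real \<Rightarrow> real) \<times> (real \<Rightarrow> real)) set" where
  "K_cone a b c = K_tilde (a 1) (b 1) (c 1) \<times> K_tilde (a 2) (b 2) (c 2)"

definition is_solution ::
  "(nat \<Rightarrow> real \<Rightarrow> real \<Rightarrow> real \<Rightarrow> real) \<Rightarrow> (nat \<Rightarrow> real \<Rightarrow> real \<Rightarrow> real) \<Rightarrow> (nat \<Rightarrow> real \<Rightarrow> real)
    \<Rightarrow> (real \<Rightarrow> real) \<Rightarrow> (real \<Rightarrow> real) \<Rightarrow> bool" where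
  "is_solution f k g u v \<longleftrightarrow>
     (\<forall>t\<in>{0..1}. u t = (LINT s|leb01. k 1 t s * g 1 s * f 1 s (u s) (v s)) \<and>
                 v t = (LINT s|leb01. k 2 t s * g 2 s * f 2 s (u s) (v s)))"

definition nontrivial_solutions ::
  "(nat \<Rightarrow> real \<Rightarrow> real \<Rightarrow> real \<Rightarrow> real) \<Rightarrow> (nat \<Rightarrow> real \<Rightarrow> real \<Rightarrow> real) \<Rightarrow> (nat \<Rightarrow> real \<Rightarrow> real)
    \<Rightarrow> (nat \<Rightarrow> real) \<Rightarrow> (nat \<Rightarrow> real) \<Rightarrow> (nat \<Rightarrow> real)
    \<Rightarrow> ((real \<Rightarrow> real) \<times> (real \<Rightarrow> real)) set" where
  "nontrivial_solutions f k g a b c =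
     {(u, v). (u, v) \<in> K_cone a b c \<and> is_solution f k g u v \<and> pair_norm (u, v) \<noteq> 0}"

definition has_at_least :: "nat \<Rightarrow> 'a set \<Rightarrow> bool" where
  "has_at_least n A \<longleftrightarrow> (\<exists>S\<subseteq>A. finite S \<and> card S = n)"

text \<open>
  Under the standing assumptions the supremum and the infimum below are over bounded sets and
  are positive.
\<close>

definition m_const :: "(real \<Rightarrow> real \<Rightarrow> real) \<Rightarrow> (real \<Rightarrow> real) \<Rightarrow> real" where
  "m_const k g = 1 / (SUP t\<in>{0..1}. LINT s|leb01. \<bar>k t s\<bar> * g s)"

definition M_const :: "(real \<Rightarrow> real \<Rightarrow> real) \<Rightarrow> (real \<Rightarrow> real) \<Rightarrow> real \<Rightarrow> real \<Rightarrow> real" where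
  "M_const k g a b = 1 / (INF t\<in>{a..b}. LINT s|lebesgue_on {a..b}. k t s * g s)"

text \<open>
  A nonlinearity satisfying the Caratheodory conditions may be unbounded on a box (on a null set
  of times), so suprema and infima of its values are taken in the extended reals.
\<close>

definition sup_on_box ::
  "(real \<Rightarrow> real \<Rightarrow> real \<Rightarrow> real) \<Rightarrow> real \<Rightarrow> real set \<Rightarrow> real set \<Rightarrow> real set \<Rightarrow> ereal" where
  "sup_on_box f \<rho> T U V = (SUP (t, u, v)\<in>T \<times> U \<times> V. ereal (f t u v / \<rho>))"

definition inf_on_box ::
  "(real \<Rightarrow> real \<Rightarrow> real \<Rightarrow> real) \<Rightarrow> real \<Rightarrow> real set \<Rightarrow> real set \<Rightarrow> real set \<Rightarrow> ereal" where
  "inf_on_box f \<rho> T U V = (INF (t, u, v)\<in>T \<times> U \<times> V. ereal (f t u v / \<rho>))"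

definition cond_I1 ::
  "(nat \<Rightarrow> real \<Rightarrow> real \<Rightarrow> real \<Rightarrow> real) \<Rightarrow> (nat \<Rightarrow> real \<Rightarrow> real \<Rightarrow> real) \<Rightarrow> (nat \<Rightarrow> real \<Rightarrow> real)
    \<Rightarrow> (nat \<Rightarrow> real) \<Rightarrow> bool" where
  "cond_I1 f k g \<rho> \<longleftrightarrow>
     (\<forall>i\<in>{1, 2}. sup_on_box (f i) (\<rho> i) {0..1} {-\<rho> 1..\<rho> 1} {-\<rho> 2..\<rho> 2} < ereal (m_const (k i) (g i)))"

definition cond_I0 ::
  "(nat \<Rightarrow> real \<Rightarrow> real \<Rightarrow> real \<Rightarrow> real) \<Rightarrow> (nat \<Rightarrow> real \<Rightarrow> real \<Rightarrow> real) \<Rightarrow> (nat \<Rightarrow> real \<Rightarrow> real)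
    \<Rightarrow> (nat \<Rightarrow> real) \<Rightarrow> (nat \<Rightarrow> real) \<Rightarrow> (nat \<Rightarrow> real) \<Rightarrow> (nat \<Rightarrow> real) \<Rightarrow> bool" where
  "cond_I0 f k g a b c \<rho> \<longleftrightarrow>
     inf_on_box (f 1) (\<rho> 1) {a 1..b 1} {\<rho> 1..\<rho> 1 / c 1} {-(\<rho> 2 / c 2)..\<rho> 2 / c 2}
       > ereal (M_const (k 1) (g 1) (a 1) (b 1)) \<and>
     inf_on_box (f 2) (\<rho> 2) {a 2..b 2} {-(\<rho> 1 / c 1)..\<rho> 1 / c 1} {\<rho> 2..\<rho> 2 / c 2}
       > ereal (M_const (k 2) (g 2) (a 2) (b 2))"

definition cond_I0_star ::
  "(nat \<Rightarrow> real \<Rightarrow> real \<Rightarrow> real \<Rightarrow> real) \<Rightarrow> (nat \<Rightarrow> real \<Rightarrow> real \<Rightarrow> real) \<Rightarrow> (nat \<Rightarrow> real \<Rightarrow> real)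
    \<Rightarrow> (nat \<Rightarrow> real) \<Rightarrow> (nat \<Rightarrow> real) \<Rightarrow> (nat \<Rightarrow> real) \<Rightarrow> (nat \<Rightarrow> real) \<Rightarrow> bool" where
  "cond_I0_star f k g a b c \<rho> \<longleftrightarrow>
     inf_on_box (f 1) (\<rho> 1) {a 1..b 1} {0..\<rho> 1 / c 1} {-(\<rho> 2 / c 2)..\<rho> 2 / c 2}
       > ereal (M_const (k 1) (g 1) (a 1) (b 1)) \<or>
     inf_on_box (f 2) (\<rho> 2) {a 2..b 2} {-(\<rho> 1 / c 1)..\<rho> 1 / c 1} {0..\<rho> 2 / c 2}
       > ereal (M_const (k 2) (g 2) (a 2) (b 2))"

end

theory Submission
  imports Defs "HOL-Complex_Analysis.Great_Picard"
begin

text \<open>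
  Solutions in \<open>K\<close> are the fixed points in \<open>K\<close> of the operator \<open>T\<close> given by the two right-hand
  sides, and \<open>T\<close> maps \<open>K\<close> into itself and is completely continuous. Two families of functionals on
  \<open>K\<close>, positively homogeneous of degree one, describe the geometry:
  \<open>norm_gauge r (u, v) = max (\<parallel>u\<parallel> / r\<^sub>1) (\<parallel>v\<parallel> / r\<^sub>2)\<close> and
  \<open>min_gauge r (u, v) = max (min u / r\<^sub>1) (min v / r\<^sub>2)\<close>, where each minimum is over \<open>[a\<^sub>i, b\<^sub>i]\<close>.
  The condition \<open>I\<^sup>1\<close> at \<open>r\<close> implies that \<open>T\<close> does not stretch on \<open>norm_gauge r = 1\<close>: there
  \<open>T w = l w\<close> forces \<open>l < 1\<close>. The condition \<open>I\<^sup>0\<close> at \<open>r\<close>, or its starred form, implies that on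
  \<open>min_gauge r = 1\<close> the equation \<open>w = T w + l (1, 1)\<close> has no solution with \<open>l \<ge> 0\<close>, because \<open>T\<close> pushes
  one component strictly above its prescribed minimum. These are
  \<open>cond_I1_no_stretch\<close>, \<open>cond_I0_no_lift\<close> and \<open>cond_I0_star_no_lift\<close>.

  Since \<open>c\<^sub>i \<parallel>w\<parallel> \<le> min w \<le> \<parallel>w\<parallel>\<close> in the cone, the inequalities between the radii yield
  that the gauge of each condition is dominated by the gauge of the preceding one. So every chain of conditions
  cuts out consecutive annuli (inner gauge at least 1, outer gauge at most 1) whose boundaries alternate
  between the two types, and it suffices to find in each annulus a fixed point off its boundary:
  fixed points in different annuli are separated by the gauges, hence distinct, and nonzero.

  A fixed point in one annulus can be had without a fixed point index. In the compressive case (no lift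
  on the inner boundary, no stretch on the outer one) \<open>T\<close> is continued from the annulus to the whole
  cone: outside by radial projection, inside by \<open>\<nu> T(w / \<nu>) + (1 - \<nu>) e\<close>, where \<open>\<nu> < 1\<close> is the inner
  gauge of \<open>w\<close>. Schauder's theorem gives a fixed point of the continuation; homogeneity turns a fixed
  point inside into a lift on the inner boundary, and one outside into a stretch on the outer boundary,
  so it lies in the annulus (\<open>compression\<close>). In the expansive case the radial reflection
  \<open>w \<mapsto> w / (p w * q w)\<close>, with \<open>q\<close> the inner and \<open>p\<close> the outer gauge, exchanges the two boundaries and
  transforms the problem into a compressive one (\<open>expansion\<close>).

  Schauder's theorem for a convex cone follows by projecting onto the convex hull of a finite net and applying
  Brouwer's theorem to the coefficients. The dimension is the size of the net, thus not known in advance,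
  so Brouwer's theorem is derived from Kuhn's combinatorial lemma for points of
  \<open>[0, 1]\<^sup>n\<close> represented as functions on the natural numbers.
\<close>

section \<open>Brouwer's theorem for the unit cube\<close>

text \<open>
  The coordinates beyond \<open>n\<close> are fixed to be \<open>0\<close>, which makes the set compact in the product
  topology and lets \<open>n\<close> be an ordinary variable.
\<close>

definition unit_cube :: "nat \<Rightarrow> (nat \<Rightarrow> real) set" where
  "unit_cube n = {x. (\<forall>i<n. 0 \<le> x i \<and> x i \<le> 1) \<and> (\<forall>i\<ge>n. x i = 0)}"

lemma unit_cube_convergent_subseq:
  assumes X: "\<And>m::nat. X m \<in> unit_cube n"
  obtains l r where "l \<in> unit_cube n" "strict_mono (r :: nat \<Rightarrow> nat)" "\<And>i. (\<lambda>m. X (r m) i) \<longlonglongrightarrow> l i"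
proof -
  have eq: "unit_cube n = (\<Pi>\<^sub>E i\<in>UNIV. if i < n then {0..1} else {0::real})"
  proof (intro set_eqI iffI)
    fix x :: "nat \<Rightarrow> real"
    assume "x \<in> (\<Pi>\<^sub>E i\<in>UNIV. if i < n then {0..1} else {0::real})"
    then have x: "x i \<in> (if i < n then {0..1} else {0::real})" for i
      by (rule PiE_mem) simp
    have "0 \<le> x i \<and> x i \<le> 1" if "i < n" for i using x[of i] that by simp
    moreover have "x i = 0" if "i \<ge> n" for i using x[of i] that by simp
    ultimately show "x \<in> unit_cube n" by (simp add: unit_cube_def)
  qed (simp add: unit_cube_def PiE_def Pi_def)
  have "compactin (product_topology (\<lambda>i::nat. euclidean) UNIV) (\<Pi>\<^sub>E i\<in>UNIV. if i < n then {0..1} else {0::real})"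
    by (subst compactin_PiE) auto
  then have "compact (unit_cube n)"
    by (simp add: eq euclidean_product_topology)
  then have "seq_compact (unit_cube n)" by (rule compact_imp_seq_compact)
  then obtain l r where l: "l \<in> unit_cube n" "strict_mono (r :: nat \<Rightarrow> nat)" "(X \<circ> r) \<longlonglongrightarrow> l"
    using X unfolding seq_compact_def by metis
  have "(\<lambda>m. X (r m) i) \<longlonglongrightarrow> l i" for i
  proof -
    have "isCont (\<lambda>x::nat \<Rightarrow> real. x i) l"
      using continuous_on_product_then_coordinatewise[OF continuous_on_id, of UNIV i]
      by (rule continuous_on_interior) simp
    from isCont_tendsto_compose[OF this l(3)] show ?thesis by (simp add: o_def)
  qed
  with l that show ?thesis by blast
qed

text \<open>
  Kuhn's lemma is applied on ever finer grids, with grid points labelled by whether a coordinate is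
  moved up or down. It yields small cells in which every coordinate is (weakly) moved up at some vertex and
  down at another one; at a limit of such cells every coordinate is fixed. Continuity is stated
  along pointwise convergent sequences, the form in which Schauder's theorem supplies it.
\<close>

theorem brouwer_unit_cube:
  fixes F :: "(nat \<Rightarrow> real) \<Rightarrow> nat \<Rightarrow> real"
  assumes range: "\<And>x i. x \<in> unit_cube n \<Longrightarrow> i < n \<Longrightarrow> 0 \<le> F x i \<and> F x i \<le> 1"
    and cont: "\<And>X x i. (\<And>m. X m \<in> unit_cube n) \<Longrightarrow> x \<in> unit_cube n \<Longrightarrow>
        (\<And>i. (\<lambda>m. X m i) \<longlonglongrightarrow> x i) \<Longrightarrow> i < n \<Longrightarrow> (\<lambda>m. F (X m) i) \<longlonglongrightarrow> F x i"
  shows "\<exists>x\<in>unit_cube n. \<forall>i<n. F x i = x i"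
proof -
  have grid: "\<exists>q::nat \<Rightarrow> nat. (\<forall>i<n. q i < Suc m) \<and>
      (\<forall>i<n. \<exists>x y. x \<in> unit_cube n \<and> y \<in> unit_cube n \<and>
        (\<forall>j<n. \<bar>x j - q j / Suc m\<bar> \<le> 1 / Suc m) \<and> (\<forall>j<n. \<bar>y j - q j / Suc m\<bar> \<le> 1 / Suc m) \<and>
        x i \<le> F x i \<and> F y i \<le> y i)" for m
  proof -
    define pt where "pt r = (\<lambda>j. if j < n then real (r j) / Suc m else 0)" for r :: "nat \<Rightarrow> nat"
(* On the upper face the label must be 1 even if the coordinate is fixed, hence the strict bound. *)
    define label where "label r i = (if r i < Suc m \<and> pt r i \<le> F (pt r) i then 0 else 1::nat)" for r i
    have pt: "pt r \<in> unit_cube n" if "\<forall>i<n. r i \<le> Suc m" for r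
    proof -
      have "real (r i) \<le> 1 + real m" if "i < n" for i
        using \<open>\<forall>i<n. r i \<le> Suc m\<close> that by (metis of_nat_Suc of_nat_le_iff)
      then show ?thesis by (simp add: pt_def unit_cube_def divide_le_eq)
    qed
    have close: "\<bar>pt r j - q j / Suc m\<bar> \<le> 1 / Suc m" if "q j \<le> r j \<and> r j \<le> q j + 1" "j < n" for r q :: "nat \<Rightarrow> nat" and j
    proof -
      have "pt r j - q j / Suc m = (real (r j) - real (q j)) / Suc m"
        using that by (simp add: pt_def diff_divide_distrib)
      moreover have "\<bar>real (r j) - real (q j)\<bar> \<le> 1" using that by auto
      ultimately show ?thesis by (simp add: divide_right_mono)
    qed
    have low: "pt r i \<le> F (pt r) i" if "label r i = 0" for r i
      using that by (auto simp: label_def split: if_splits)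
    have high: "F (pt r) i \<le> pt r i" if "label r i \<noteq> 0" "\<forall>i<n. r i \<le> Suc m" "i < n" for r i
    proof (cases "r i < Suc m")
      case True
      with that show ?thesis by (auto simp: label_def split: if_splits)
    next
      case False
      with that have "r i = Suc m" by (metis le_antisym not_less)
      with that have "pt r i = 1" by (simp add: pt_def)
      with range[OF pt[OF that(2)] that(3)] show ?thesis by simp
    qed
    obtain q where q: "\<forall>i<n. q i < Suc m"
      and sw: "\<forall>i<n. \<exists>r s. (\<forall>j<n. q j \<le> r j \<and> r j \<le> q j + 1) \<and> (\<forall>j<n. q j \<le> s j \<and> s j \<le> q j + 1) \<and> label r i \<noteq> label s i"
    proof (rule kuhn_lemma[of "Suc m" n label])
      show "\<forall>x. (\<forall>i<n. x i \<le> Suc m) \<longrightarrow> (\<forall>i<n. x i = 0 \<longrightarrow> label x i = 0)"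
      proof (intro allI impI)
        fix x i assume "\<forall>i<n. x i \<le> Suc m" "i < n" "x i = 0"
        with range[OF pt, of x i] show "label x i = 0" by (simp add: label_def pt_def[of x])
      qed
    qed (simp_all add: label_def)
    show ?thesis
    proof (intro exI[of _ q] conjI allI impI)
      fix i assume i: "i < n"
      obtain r s where r: "\<forall>j<n. q j \<le> r j \<and> r j \<le> q j + 1" and s: "\<forall>j<n. q j \<le> s j \<and> s j \<le> q j + 1"
        and ne: "label r i \<noteq> label s i"
        using sw i by blast
      have ok: "\<forall>i<n. r' i \<le> Suc m" if "\<forall>j<n. q j \<le> r' j \<and> r' j \<le> q j + 1" for r'
      proof (intro allI impI)
        fix i assume "i < n"
        with that q have "r' i \<le> q i + 1" "q i < Suc m" by auto
        then show "r' i \<le> Suc m" by linarith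
      qed
      have fin: "\<exists>x y. x \<in> unit_cube n \<and> y \<in> unit_cube n \<and>
        (\<forall>j<n. \<bar>x j - q j / Suc m\<bar> \<le> 1 / Suc m) \<and> (\<forall>j<n. \<bar>y j - q j / Suc m\<bar> \<le> 1 / Suc m) \<and>
        x i \<le> F x i \<and> F y i \<le> y i"
        if r: "\<forall>j<n. q j \<le> r j \<and> r j \<le> q j + 1" and s: "\<forall>j<n. q j \<le> s j \<and> s j \<le> q j + 1"
          and "label r i = 0" "label s i \<noteq> 0" for r s
      proof (rule exI[of _ "pt r"], rule exI[of _ "pt s"], intro conjI)
        show "pt r \<in> unit_cube n" "pt s \<in> unit_cube n"
          by (rule pt[OF ok[OF r]], rule pt[OF ok[OF s]])
        show "\<forall>j<n. \<bar>pt r j - q j / Suc m\<bar> \<le> 1 / Suc m" "\<forall>j<n. \<bar>pt s j - q j / Suc m\<bar> \<le> 1 / Suc m"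
          using close r s by blast+
        show "pt r i \<le> F (pt r) i" by (rule low[OF that(3)])
        show "F (pt s) i \<le> pt s i" by (rule high[OF that(4) ok[OF s] i])
      qed
      show "\<exists>x y. x \<in> unit_cube n \<and> y \<in> unit_cube n \<and>
        (\<forall>j<n. \<bar>x j - q j / Suc m\<bar> \<le> 1 / Suc m) \<and> (\<forall>j<n. \<bar>y j - q j / Suc m\<bar> \<le> 1 / Suc m) \<and>
        x i \<le> F x i \<and> F y i \<le> y i"
      proof (cases "label r i = 0")
        case True
        with ne show ?thesis by (intro fin[OF r s]) auto
      next
        case False
        then have "label s i = 0" using ne by (simp add: label_def split: if_splits)
        with False show ?thesis by (intro fin[OF s r]) auto
      qed
    qed (use q in auto)
  qed
  then obtain q :: "nat \<Rightarrow> nat \<Rightarrow> nat" where q: "\<And>m i. i < n \<Longrightarrow> q m i < Suc m"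
    and ex: "\<And>m i. i < n \<Longrightarrow> \<exists>x y. x \<in> unit_cube n \<and> y \<in> unit_cube n \<and>
        (\<forall>j<n. \<bar>x j - q m j / Suc m\<bar> \<le> 1 / Suc m) \<and> (\<forall>j<n. \<bar>y j - q m j / Suc m\<bar> \<le> 1 / Suc m) \<and>
        x i \<le> F x i \<and> F y i \<le> y i"
    by metis
(* The lower corners of the cells; all points chosen in the cells have the same limit. *)
  define Z where "Z m = (\<lambda>j. if j < n then real (q m j) / Suc m else 0)" for m
  have "Z m \<in> unit_cube n" for m
  proof -
    have "real (q m i) \<le> 1 + real m" if "i < n" for i
      using q[OF that, of m] by linarith
    then show ?thesis by (simp add: Z_def unit_cube_def divide_le_eq)
  qed
  then obtain l r where l: "l \<in> unit_cube n" and r: "strict_mono (r :: nat \<Rightarrow> nat)"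
    and lim: "\<And>i. (\<lambda>m. Z (r m) i) \<longlonglongrightarrow> l i"
    using unit_cube_convergent_subseq[of Z n] by blast
  have small: "(\<lambda>m. 1 / real (Suc (r m))) \<longlonglongrightarrow> 0"
    using LIMSEQ_subseq_LIMSEQ[OF LIMSEQ_inverse_real_of_nat r] by (simp add: o_def inverse_eq_divide)
  have tend: "(\<lambda>m. X m j) \<longlonglongrightarrow> l j"
    if X: "\<And>m. X m \<in> unit_cube n" and near: "\<And>m. \<forall>j<n. \<bar>X m j - q (r m) j / Suc (r m)\<bar> \<le> 1 / Suc (r m)" for X j
  proof (cases "j < n")
    case True
    have "(\<lambda>m. X m j - Z (r m) j) \<longlonglongrightarrow> 0"
      by (rule tendsto_0_le[OF small, of _ 1]) (use near True in \<open>auto simp: Z_def\<close>)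
    from tendsto_add[OF this lim[of j]] show ?thesis by simp
  next
    case False
    then have "X m j = 0" "l j = 0" for m using X l by (auto simp: unit_cube_def)
    then show ?thesis by simp
  qed
  have "F l i = l i" if i: "i < n" for i
  proof -
    obtain X Y where X: "\<And>m. X m \<in> unit_cube n" and Y: "\<And>m. Y m \<in> unit_cube n"
      and nX: "\<And>m. \<forall>j<n. \<bar>X m j - q (r m) j / Suc (r m)\<bar> \<le> 1 / Suc (r m)"
      and nY: "\<And>m. \<forall>j<n. \<bar>Y m j - q (r m) j / Suc (r m)\<bar> \<le> 1 / Suc (r m)"
      and le: "\<And>m. X m i \<le> F (X m) i" and ge: "\<And>m. F (Y m) i \<le> Y m i"
      using ex[OF i, of "r _"] by metis
    have "l i \<le> F l i"
      by (rule LIMSEQ_le[OF tend[OF X nX] cont[OF X l tend[OF X nX] i]]) (use le in auto)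
    moreover have "F l i \<le> l i"
      by (rule LIMSEQ_le[OF cont[OF Y l tend[OF Y nY] i] tend[OF Y nY]]) (use ge in auto)
    ultimately show ?thesis by simp
  qed
  with l show ?thesis by blast
qed

section \<open>Schauder fixed points in a cone\<close>

text \<open>
  The Schauder projection: every point \<open>z\<close> of \<open>C\<close> is within \<open>e\<close> of a convex combination of
  the points of a finite net that are closer to \<open>z\<close> than \<open>e\<close>, with weights \<open>\<mu> z i / \<sigma> z\<close> continuous in
  \<open>z\<close>. Nonnegative combinations of net points stay in the cone, so mapping coefficients \<open>x\<close> to the weights
  of \<open>S (\<Sum>i. x i * y i)\<close> is a self-map of the unit cube; its fixed point gives the almost fixed point.
\<close>

lemma schauder_projection_approx:
  fixes S :: "'a::real_normed_vector \<Rightarrow> 'a"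
  assumes add: "\<And>x y. x \<in> K \<Longrightarrow> y \<in> K \<Longrightarrow> x + y \<in> K"
    and scale: "\<And>t x. 0 \<le> t \<Longrightarrow> x \<in> K \<Longrightarrow> t *\<^sub>R x \<in> K"
    and "K \<noteq> {}" and cont: "continuous_on K S"
    and S: "S ` K \<subseteq> C" and C: "compact C" "C \<subseteq> K" and e: "e > 0"
  shows "\<exists>x\<in>K. norm (x - S x) \<le> e"
proof -
  have zero: "0 \<in> K" using scale[of 0] \<open>K \<noteq> {}\<close> by auto
  obtain Y where Y: "finite Y" "Y \<subseteq> C" "C \<subseteq> (\<Union>y\<in>Y. ball y e)"
    using seq_compact_imp_totally_bounded[OF compact_imp_seq_compact[OF C(1)]] e by metis
  obtain y where y: "bij_betw y {0..<card Y} Y" using ex_bij_betw_nat_finite[OF Y(1)] by blast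
  define n where "n = card Y"
  have yK: "y i \<in> K" if "i < n" for i
  proof -
    have "y i \<in> Y" by (rule bij_betw_apply[OF y]) (use that in \<open>simp add: n_def\<close>)
    then show ?thesis using Y(2) C(2) by blast
  qed
  define \<mu> where "\<mu> z i = max 0 (e - dist (y i) z)" for z i
  define \<sigma> where "\<sigma> z = (\<Sum>i<n. \<mu> z i)" for z
  define N where "N x = (\<Sum>i<n. x i *\<^sub>R y i)" for x
  have \<mu>0: "0 \<le> \<mu> z i" for z i by (simp add: \<mu>_def)
  have \<mu>\<sigma>: "\<mu> z i \<le> \<sigma> z" if "i < n" for z i
    unfolding \<sigma>_def using that \<mu>0 by (intro member_le_sum) auto
  have \<sigma>: "0 < \<sigma> z" if z: "z \<in> C" for z
  proof -
    obtain w where "w \<in> Y" "z \<in> ball w e" using Y(3) z by blast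
    then obtain i where i: "i < n" "y i = w"
      using y unfolding n_def bij_betw_def by (metis atLeastLessThan_iff imageE)
    then have "0 < \<mu> z i" using \<open>z \<in> ball w e\<close> by (simp add: \<mu>_def)
    also have "\<dots> \<le> \<sigma> z" by (rule \<mu>\<sigma>[OF i(1)])
    finally show ?thesis .
  qed
  have NK: "N x \<in> K" if "x \<in> unit_cube n" for x
  proof -
    have "(\<Sum>i<m. x i *\<^sub>R y i) \<in> K" if "m \<le> n" for m
      using that by (induction m) (use \<open>x \<in> unit_cube n\<close> zero yK in \<open>auto simp: unit_cube_def intro!: add scale\<close>)
    then show ?thesis by (simp add: N_def)
  qed
  have SN: "S (N x) \<in> C" if "x \<in> unit_cube n" for x using NK[OF that] S by blast
  have "\<exists>x\<in>unit_cube n. \<forall>i<n. \<mu> (S (N x)) i / \<sigma> (S (N x)) = x i"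
  proof (rule brouwer_unit_cube)
    fix x i assume "x \<in> unit_cube n" "i < n"
    then show "0 \<le> \<mu> (S (N x)) i / \<sigma> (S (N x)) \<and> \<mu> (S (N x)) i / \<sigma> (S (N x)) \<le> 1"
      using \<sigma>[OF SN[of x]] \<mu>\<sigma>[of i "S (N x)"] \<mu>0[of "S (N x)" i] by (simp add: divide_le_eq)
  next
    fix X x i assume X: "\<And>m::nat. X m \<in> unit_cube n" and x: "x \<in> unit_cube n" and i: "i < n"
      and lim: "\<And>i. (\<lambda>m. X m i) \<longlonglongrightarrow> x i"
    have "(\<lambda>m. N (X m)) \<longlonglongrightarrow> N x" unfolding N_def by (intro tendsto_intros lim)
    then have "(\<lambda>m. S (N (X m))) \<longlonglongrightarrow> S (N x)"
      by (rule continuous_on_tendsto_compose[OF cont]) (use NK X x in auto)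
    then show "(\<lambda>m. \<mu> (S (N (X m))) i / \<sigma> (S (N (X m)))) \<longlonglongrightarrow> \<mu> (S (N x)) i / \<sigma> (S (N x))"
      using \<sigma>[OF SN[OF x]] unfolding \<sigma>_def \<mu>_def by (intro tendsto_intros) auto
  qed
  then obtain x where x: "x \<in> unit_cube n" and fp: "\<And>i. i < n \<Longrightarrow> x i = \<mu> (S (N x)) i / \<sigma> (S (N x))"
    by metis
  define z where "z = S (N x)"
  have z: "0 < \<sigma> z" using \<sigma>[OF SN[OF x]] by (simp add: z_def)
  have sum1: "(\<Sum>i<n. \<mu> z i / \<sigma> z) = 1"
    using z by (simp add: sum_divide_distrib[symmetric] \<sigma>_def[symmetric])
  have "N x - z = (\<Sum>i<n. (\<mu> z i / \<sigma> z) *\<^sub>R y i) - (\<Sum>i<n. \<mu> z i / \<sigma> z) *\<^sub>R z"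
  proof -
    have "x i *\<^sub>R y i = (\<mu> z i / \<sigma> z) *\<^sub>R y i" if "i < n" for i
      unfolding z_def by (subst fp[OF that]) (rule refl)
    then have "N x = (\<Sum>i<n. (\<mu> z i / \<sigma> z) *\<^sub>R y i)"
      unfolding N_def by (intro sum.cong) auto
    then show ?thesis by (simp only: sum1 scaleR_one)
  qed
  then have "norm (N x - z) = norm (\<Sum>i<n. (\<mu> z i / \<sigma> z) *\<^sub>R (y i - z))"
    by (simp only: scaleR_sum_left sum_subtractf scaleR_diff_right)
  also have "\<dots> \<le> (\<Sum>i<n. \<mu> z i / \<sigma> z * e)"
  proof (rule sum_norm_le)
    fix i assume "i \<in> {..<n}"
    have "\<mu> z i * norm (y i - z) \<le> \<mu> z i * e"
    proof (cases "norm (y i - z) \<le> e")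
      case True
      then show ?thesis by (rule mult_left_mono) (rule \<mu>0)
    next
      case False
      then have "\<mu> z i = 0" unfolding \<mu>_def dist_norm by linarith
      then show ?thesis by simp
    qed
    then show "norm ((\<mu> z i / \<sigma> z) *\<^sub>R (y i - z)) \<le> \<mu> z i / \<sigma> z * e"
      using z \<mu>0[of z i] divide_right_mono[OF _ less_imp_le[OF z], of "\<mu> z i * norm (y i - z)" "\<mu> z i * e"]
      by simp
  qed
  also have "\<dots> = e" by (simp only: sum_distrib_right[symmetric] sum1 mult_1)
  finally show ?thesis using NK[OF x] by (auto simp: z_def)
qed

theorem schauder_cone:
  fixes S :: "'a::real_normed_vector \<Rightarrow> 'a"
  assumes "\<And>x y. x \<in> K \<Longrightarrow> y \<in> K \<Longrightarrow> x + y \<in> K"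
    and "\<And>t x. 0 \<le> t \<Longrightarrow> x \<in> K \<Longrightarrow> t *\<^sub>R x \<in> K"
    and "K \<noteq> {}" and cont: "continuous_on K S"
    and S: "S ` K \<subseteq> C" and C: "compact C" "C \<subseteq> K"
  shows "\<exists>x\<in>K. S x = x"
proof -
  have "\<exists>x\<in>K. norm (x - S x) \<le> 1 / real (Suc m)" for m
    by (rule schauder_projection_approx[OF assms]) auto
  then obtain x where xK: "\<And>m. x m \<in> K" and x: "\<And>m. norm (x m - S (x m)) \<le> 1 / real (Suc m)"
    by metis
  have "\<And>m. S (x m) \<in> C" using xK S by auto
  then obtain l r where l: "l \<in> C" and r: "strict_mono (r :: nat \<Rightarrow> nat)" and lim: "((\<lambda>m. S (x m)) \<circ> r) \<longlonglongrightarrow> l"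
    using C(1) unfolding compact_eq_seq_compact_metric seq_compact_def by metis
  have "(\<lambda>m. norm (x m - S (x m))) \<longlonglongrightarrow> 0"
    by (rule tendsto_sandwich[OF _ _ tendsto_const LIMSEQ_inverse_real_of_nat])
      (use x in \<open>auto simp: inverse_eq_divide\<close>)
  then have "(\<lambda>m. x m - S (x m)) \<longlonglongrightarrow> 0" by (rule tendsto_norm_zero_cancel)
  from tendsto_add[OF LIMSEQ_subseq_LIMSEQ[OF this r] lim]
  have xl: "(\<lambda>m. x (r m)) \<longlonglongrightarrow> l" by (simp add: o_def)
  have "(\<lambda>m. S (x (r m))) \<longlonglongrightarrow> S l"
    by (rule continuous_on_tendsto_compose[OF cont xl]) (use xK l C in auto)
  then have "S l = l" by (rule LIMSEQ_unique) (use lim in \<open>simp add: o_def\<close>)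
  with l C show ?thesis by blast
qed

section \<open>Fixed points in annuli of a cone\<close>

text \<open>
  \<open>q\<close> is the inner and \<open>p\<close> the outer gauge. By homogeneity \<open>p \<le> q\<close> says that on every ray the
  point with \<open>q = 1\<close> does not come after the point with \<open>p = 1\<close>.
\<close>

locale cone_annulus =
  fixes K :: "'a::real_normed_vector set" and p q :: "'a \<Rightarrow> real"
  assumes add: "\<And>x y. x \<in> K \<Longrightarrow> y \<in> K \<Longrightarrow> x + y \<in> K"
    and scale: "\<And>t x. 0 \<le> t \<Longrightarrow> x \<in> K \<Longrightarrow> t *\<^sub>R x \<in> K"
    and p_cont: "continuous_on K p" and q_cont: "continuous_on K q"
    and p_hom: "\<And>t x. 0 \<le> t \<Longrightarrow> x \<in> K \<Longrightarrow> p (t *\<^sub>R x) = t * p x"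
    and q_hom: "\<And>t x. 0 \<le> t \<Longrightarrow> x \<in> K \<Longrightarrow> q (t *\<^sub>R x) = t * q x"
    and p_pos: "\<And>x. x \<in> K \<Longrightarrow> x \<noteq> 0 \<Longrightarrow> 0 < p x"
    and p_le_q: "\<And>x. x \<in> K \<Longrightarrow> p x \<le> q x"
begin

definition annulus :: "'a set" where
  "annulus = {x \<in> K. 1 \<le> q x \<and> p x \<le> 1}"

lemma q_pos: "x \<in> K \<Longrightarrow> x \<noteq> 0 \<Longrightarrow> 0 < q x"
  using p_pos p_le_q by (rule less_le_trans)

lemma zero_in: "x \<in> K \<Longrightarrow> 0 \<in> K"
  using scale[of 0 x] by simp

lemma gauge_zero: assumes "x \<in> K" shows "p 0 = 0" "q 0 = 0"
  using p_hom[of 0 x] q_hom[of 0 x] assms by simp_all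

lemma gauge_nonneg: assumes "x \<in> K" shows "0 \<le> p x" "0 \<le> q x"
proof -
  show "0 \<le> p x"
  proof (cases "x = 0")
    case True
    then show ?thesis using gauge_zero[OF assms] by simp
  next
    case False
    then show ?thesis using p_pos[OF assms] by simp
  qed
  then show "0 \<le> q x" using p_le_q[OF assms] by simp
qed

text \<open>
  The map \<open>S\<close> below continues \<open>T\<close> to all of \<open>K\<close>: \<open>\<pi>\<close> projects radially to the annulus, and \<open>\<nu>\<close> is
  the inner gauge truncated at \<open>1\<close>, so that \<open>S\<close> agrees with \<open>T\<close> on the annulus, with \<open>T \<circ> \<pi>\<close> outside it,
  and with \<open>\<nu> T(\<pi> x) + (1 - \<nu>) e\<close> inside. If \<open>S x = x\<close> with \<open>0 < \<nu> < 1\<close>, division by \<open>\<nu>\<close> gives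
  \<open>\<pi> x = T(\<pi> x) + l e\<close> with \<open>l = (1 - \<nu>) / \<nu>\<close>, excluded by the inner condition; and \<open>S 0 = e \<noteq> 0\<close>. If
  \<open>p x > 1\<close>, then \<open>T(\<pi> x) = p x * \<pi> x\<close>, excluded by the outer condition.
\<close>

theorem compression:
  assumes T_cont: "continuous_on annulus T" and TC: "T ` annulus \<subseteq> C"
    and C: "compact C" "C \<subseteq> K"
    and e: "e \<in> K" "e \<noteq> 0"
    and inner: "\<And>x l. x \<in> annulus \<Longrightarrow> q x = 1 \<Longrightarrow> 0 \<le> l \<Longrightarrow> x \<noteq> T x + l *\<^sub>R e"
    and outer: "\<And>x l. x \<in> annulus \<Longrightarrow> p x = 1 \<Longrightarrow> 1 \<le> l \<Longrightarrow> T x \<noteq> l *\<^sub>R x"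
  shows "\<exists>x\<in>K. 1 < q x \<and> p x < 1 \<and> T x = x"
proof -
  define \<nu> where "\<nu> x = min 1 (q x)" for x
  define \<alpha> where "\<alpha> x = max (p x) (\<nu> x)" for x
  define \<pi> where "\<pi> x = inverse (\<alpha> x) *\<^sub>R x" for x
  define S where "S x = \<nu> x *\<^sub>R T (\<pi> x) + (1 - \<nu> x) *\<^sub>R e" for x
  have \<nu>: "0 \<le> \<nu> x" "\<nu> x \<le> 1" if "x \<in> K" for x
    using gauge_nonneg[OF that] by (auto simp: \<nu>_def)
  have \<alpha>_pos: "0 < \<alpha> x" if "x \<in> K" "x \<noteq> 0" for x
    using p_pos[OF that] by (simp add: \<alpha>_def)
  have \<pi>A: "\<pi> x \<in> annulus" if x: "x \<in> K" "x \<noteq> 0" for x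
  proof -
    have a: "0 < \<alpha> x" by (rule \<alpha>_pos[OF x])
    have "\<alpha> x \<le> q x" "p x \<le> \<alpha> x" using p_le_q[OF x(1)] by (auto simp: \<alpha>_def \<nu>_def)
    then have "1 \<le> inverse (\<alpha> x) * q x" "inverse (\<alpha> x) * p x \<le> 1"
      using a by (auto simp: field_simps)
    then show ?thesis using a x by (simp add: annulus_def \<pi>_def scale p_hom q_hom)
  qed
  obtain M where M: "\<And>y. y \<in> C \<Longrightarrow> norm y \<le> M"
    using compact_imp_bounded[OF C(1)] unfolding bounded_iff by blast
  have TM: "T (\<pi> x) \<in> C" if "x \<in> K" "x \<noteq> 0" for x using \<pi>A[OF that] TC by blast
  have \<nu>_cont: "continuous_on K \<nu>" unfolding \<nu>_def by (intro continuous_intros q_cont)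
  have "continuous_on K (\<lambda>x. \<nu> x *\<^sub>R T (\<pi> x))"
  proof (rule continuous_on_sequentiallyI)
    fix u a assume u: "\<forall>n. u n \<in> K" and a: "a \<in> K" and lim: "u \<longlonglongrightarrow> a"
    have \<nu>lim: "(\<lambda>n. \<nu> (u n)) \<longlonglongrightarrow> \<nu> a"
      by (rule continuous_on_tendsto_compose[OF \<nu>_cont lim a]) (use u in auto)
(* The projection need not be continuous at 0, but T is bounded on the annulus and the factor vanishes there. *)
    show "(\<lambda>n. \<nu> (u n) *\<^sub>R T (\<pi> (u n))) \<longlonglongrightarrow> \<nu> a *\<^sub>R T (\<pi> a)"
    proof (cases "a = 0")
      case True
      have \<nu>a: "\<nu> a = 0" using True gauge_zero[OF a] by (simp add: \<nu>_def)
      have "(\<lambda>n. \<nu> (u n) *\<^sub>R T (\<pi> (u n))) \<longlonglongrightarrow> 0"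
      proof (rule tendsto_0_le[OF \<nu>lim[unfolded \<nu>a], of _ M], intro always_eventually allI)
        fix n
        show "norm (\<nu> (u n) *\<^sub>R T (\<pi> (u n))) \<le> norm (\<nu> (u n)) * M"
        proof (cases "u n = 0")
          case True
          then show ?thesis using gauge_zero[OF a] by (simp add: \<nu>_def)
        next
          case False
          then show ?thesis using M[OF TM[of "u n"]] u by (simp add: mult_left_mono)
        qed
      qed
      then show ?thesis by (simp add: \<nu>a)
    next
      case False
      have "continuous_on (K - {0}) \<pi>"
        unfolding \<pi>_def \<alpha>_def \<nu>_def
        by (intro continuous_intros continuous_on_subset[OF p_cont] continuous_on_subset[OF q_cont])
          (use \<alpha>_pos in \<open>force simp: \<alpha>_def \<nu>_def\<close>)+
      then have T\<pi>: "continuous_on (K - {0}) (\<lambda>x. T (\<pi> x))"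
        by (rule continuous_on_compose2[OF T_cont]) (use \<pi>A in auto)
      have "(\<lambda>n. T (\<pi> (u n))) \<longlonglongrightarrow> T (\<pi> a)"
        using tendsto_imp_eventually_ne[OF lim False] u a False
        by (intro continuous_on_tendsto_compose[OF T\<pi> lim]) (auto elim: eventually_mono)
      with \<nu>lim show ?thesis by (rule tendsto_scaleR)
    qed
  qed
  then have S_cont: "continuous_on K S"
    unfolding S_def by (rule continuous_on_add) (intro continuous_intros \<nu>_cont)
  define D where "D = (\<lambda>(t, y). t *\<^sub>R y + (1 - t) *\<^sub>R e) ` ({0..1} \<times> insert 0 C)"
  have "compact D" unfolding D_def
    by (intro compact_continuous_image compact_Times compact_insert C)
      (auto simp: case_prod_unfold intro!: continuous_intros)
  moreover have "D \<subseteq> K" using C(2) e zero_in[OF e(1)] by (auto simp: D_def intro!: add scale)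
  moreover have "S ` K \<subseteq> D"
  proof clarify
    fix x assume x: "x \<in> K"
    show "S x \<in> D"
    proof (cases "x = 0")
      case True
      then have "\<nu> x = 0" using gauge_zero[OF x] by (simp add: \<nu>_def)
      then have "S x = (\<lambda>(t, y). t *\<^sub>R y + (1 - t) *\<^sub>R e) (0, 0)" by (simp add: S_def)
      then show ?thesis unfolding D_def by (rule image_eqI) auto
    next
      case False
      have "S x = (\<lambda>(t, y). t *\<^sub>R y + (1 - t) *\<^sub>R e) (\<nu> x, T (\<pi> x))" by (simp add: S_def)
      then show ?thesis unfolding D_def by (rule image_eqI) (use \<nu>[OF x] TM[OF x False] in auto)
    qed
  qed
  ultimately obtain x where x: "x \<in> K" and fp: "S x = x"
    using schauder_cone[OF add scale _ S_cont] e(1) by blast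
  have x0: "x \<noteq> 0"
  proof
    assume "x = 0"
    then have "S x = e" using gauge_zero[OF x] by (simp add: S_def \<nu>_def)
    with fp \<open>x = 0\<close> e show False by simp
  qed
  have q1: "1 \<le> q x"
  proof (rule ccontr)
    assume "\<not> 1 \<le> q x"
    then have \<nu>x: "\<nu> x = q x" and \<alpha>x: "\<alpha> x = q x" and less: "q x < 1"
      using p_le_q[OF x] by (auto simp: \<nu>_def \<alpha>_def)
    have pos: "0 < q x" by (rule q_pos[OF x x0])
    have "q (\<pi> x) = 1" using pos x by (simp add: \<pi>_def \<alpha>x q_hom)
    moreover have "\<pi> x = T (\<pi> x) + ((1 - q x) / q x) *\<^sub>R e"
    proof -
      have "\<pi> x = inverse (q x) *\<^sub>R S x" by (simp add: fp \<pi>_def \<alpha>x)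
      also have "\<dots> = T (\<pi> x) + ((1 - q x) / q x) *\<^sub>R e"
        using pos by (simp add: S_def \<nu>x scaleR_add_right divide_inverse mult.commute)
      finally show ?thesis .
    qed
    ultimately show False using inner[OF \<pi>A[OF x x0], of "(1 - q x) / q x"] pos less by simp
  qed
  then have \<nu>x: "\<nu> x = 1" by (simp add: \<nu>_def)
  have Tx: "T (\<pi> x) = x" using fp by (simp add: S_def \<nu>x)
  have p1: "p x \<le> 1"
  proof (rule ccontr)
    assume less: "\<not> p x \<le> 1"
    then have \<alpha>x: "\<alpha> x = p x" by (simp add: \<alpha>_def \<nu>x)
    have "p (\<pi> x) = 1" using less x by (simp add: \<pi>_def \<alpha>x p_hom)
    moreover have "T (\<pi> x) = p x *\<^sub>R \<pi> x"
      unfolding Tx using less by (simp add: \<pi>_def \<alpha>x)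
    ultimately show False using outer[OF \<pi>A[OF x x0], of "p x"] less by simp
  qed
  have \<pi>x: "\<pi> x = x" using p1 by (simp add: \<pi>_def \<alpha>_def \<nu>x)
  with Tx have Tx: "T x = x" by simp
  have xA: "x \<in> annulus" using x q1 p1 by (simp add: annulus_def)
  have "q x \<noteq> 1" using inner[OF xA, of 0] Tx by auto
  moreover have "p x \<noteq> 1" using outer[OF xA, of 1] Tx by auto
  ultimately show ?thesis using x q1 p1 Tx by force
qed

text \<open>
  The radial reflection \<open>\<iota> x = x / (p x * q x)\<close> satisfies \<open>p (\<iota> x) = 1 / q x\<close> and
  \<open>q (\<iota> x) = 1 / p x\<close>, so it maps the annulus to itself and exchanges its boundaries. The rescaled map
  \<open>x \<mapsto> p x * q x * T (\<iota> x)\<close> satisfies the hypotheses of \<open>compression\<close>, and \<open>\<iota>\<close> sends its fixed points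
  to fixed points of \<open>T\<close>. The bound \<open>q \<le> B p\<close> keeps the factor \<open>p x * q x\<close> bounded, hence the range of the
  rescaled map relatively compact.
\<close>

theorem expansion:
  assumes T_cont: "continuous_on annulus T" and TC: "T ` annulus \<subseteq> C"
    and C: "compact C" "C \<subseteq> K"
    and e: "e \<in> K" "e \<noteq> 0"
    and q_le: "\<And>x. x \<in> K \<Longrightarrow> q x \<le> B * p x"
    and inner: "\<And>x l. x \<in> annulus \<Longrightarrow> q x = 1 \<Longrightarrow> 1 \<le> l \<Longrightarrow> T x \<noteq> l *\<^sub>R x"
    and outer: "\<And>x l. x \<in> annulus \<Longrightarrow> p x = 1 \<Longrightarrow> 0 \<le> l \<Longrightarrow> x \<noteq> T x + l *\<^sub>R e"
  shows "\<exists>x\<in>K. 1 < q x \<and> p x < 1 \<and> T x = x"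
proof -
  define \<sigma> where "\<sigma> x = p x * q x" for x
  define \<iota> where "\<iota> x = inverse (\<sigma> x) *\<^sub>R x" for x
  have A: "x \<in> K" "1 \<le> q x" "p x \<le> 1" "0 < p x" "0 < q x" "0 < \<sigma> x" "\<sigma> x \<le> max 0 B" if "x \<in> annulus" for x
  proof -
    show x: "x \<in> K" "1 \<le> q x" "p x \<le> 1" using that by (auto simp: annulus_def)
    then have "x \<noteq> 0" using gauge_zero by fastforce
    then show pos: "0 < p x" "0 < q x" using p_pos q_pos x by auto
    then show "0 < \<sigma> x" by (simp add: \<sigma>_def)
    have "\<sigma> x \<le> 1 * q x" unfolding \<sigma>_def using x pos by (intro mult_right_mono) auto
    also have "q x \<le> B * p x" using q_le x by simp
    also have "\<dots> \<le> max 0 B * 1" using x pos by (intro mult_mono) auto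
    finally show "\<sigma> x \<le> max 0 B" by simp
  qed
  have \<iota>p: "p (\<iota> x) = 1 / q x" and \<iota>q: "q (\<iota> x) = 1 / p x" if "x \<in> annulus" for x
    using A[OF that] by (auto simp: \<iota>_def \<sigma>_def p_hom q_hom divide_simps)
  have \<iota>A: "\<iota> x \<in> annulus" if "x \<in> annulus" for x
    using A[OF that] \<iota>p[OF that] \<iota>q[OF that] scale[of "inverse (\<sigma> x)" x] unfolding annulus_def
    by (simp add: \<iota>_def)
  have \<sigma>\<iota>: "\<sigma> x *\<^sub>R \<iota> x = x" if "x \<in> annulus" for x
    using A(6)[OF that] by (simp add: \<iota>_def)
  define T' where "T' x = \<sigma> x *\<^sub>R T (\<iota> x)" for x
  have \<sigma>_cont: "continuous_on annulus \<sigma>"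
    unfolding \<sigma>_def by (intro continuous_intros continuous_on_subset[OF p_cont] continuous_on_subset[OF q_cont])
      (auto simp: annulus_def)
  have \<iota>_cont: "continuous_on annulus \<iota>"
    unfolding \<iota>_def using A(6) by (intro continuous_intros \<sigma>_cont) force
  have T'_cont: "continuous_on annulus T'"
    unfolding T'_def using \<iota>A
    by (intro continuous_intros \<sigma>_cont continuous_on_compose2[OF T_cont \<iota>_cont]) auto
  define D where "D = (\<lambda>(t, y). t *\<^sub>R y) ` ({0..max 0 B} \<times> C)"
  have D: "compact D" unfolding D_def
    by (intro compact_continuous_image compact_Times C) (auto simp: case_prod_unfold intro!: continuous_intros)
  have DK: "D \<subseteq> K" using C(2) by (auto simp: D_def intro!: scale)
  have T'D: "T' ` annulus \<subseteq> D"
  proof clarify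
    fix x assume x: "x \<in> annulus"
    have "T' x = (\<lambda>(t, y). t *\<^sub>R y) (\<sigma> x, T (\<iota> x))" by (simp add: T'_def)
    then show "T' x \<in> D"
      unfolding D_def by (rule image_eqI) (use A(6,7)[OF x] \<iota>A[OF x] TC in \<open>auto simp: less_imp_le\<close>)
  qed
  have "\<exists>x\<in>K. 1 < q x \<and> p x < 1 \<and> T' x = x"
  proof (rule compression[OF T'_cont T'D D DK e])
    fix x l assume x: "x \<in> annulus" "q x = 1" "0 \<le> (l::real)"
    show "x \<noteq> T' x + l *\<^sub>R e"
    proof
      assume eq: "x = T' x + l *\<^sub>R e"
      have "\<iota> x = inverse (\<sigma> x) *\<^sub>R (T' x + l *\<^sub>R e)" using eq by (simp add: \<iota>_def)
      also have "\<dots> = T (\<iota> x) + (inverse (\<sigma> x) * l) *\<^sub>R e"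
        using A(6)[OF x(1)] by (simp add: T'_def scaleR_add_right)
      finally show False
        using outer[OF \<iota>A[OF x(1)], of "inverse (\<sigma> x) * l"] \<iota>p[OF x(1)] x A(6)[OF x(1)] by simp
    qed
  next
    fix x l assume x: "x \<in> annulus" "p x = 1" "1 \<le> (l::real)"
    show "T' x \<noteq> l *\<^sub>R x"
    proof
      assume "T' x = l *\<^sub>R x"
      then have "inverse (\<sigma> x) *\<^sub>R T' x = l *\<^sub>R \<iota> x" by (simp add: \<iota>_def)
      then have "T (\<iota> x) = l *\<^sub>R \<iota> x" using A(6)[OF x(1)] by (simp add: T'_def)
      then show False using inner[OF \<iota>A[OF x(1)] _ x(3)] \<iota>q[OF x(1)] x by simp
    qed
  qed
  then obtain x where x: "x \<in> K" "1 < q x" "p x < 1" and fp: "T' x = x" by blast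
  have xA: "x \<in> annulus" using x by (simp add: annulus_def)
  have "T (\<iota> x) = \<iota> x"
  proof -
    have "\<sigma> x *\<^sub>R T (\<iota> x) = \<sigma> x *\<^sub>R \<iota> x" using fp \<sigma>\<iota>[OF xA] by (simp add: T'_def)
    then show ?thesis using A(6)[OF xA] by simp
  qed
  moreover have "1 < q (\<iota> x)" "p (\<iota> x) < 1" using \<iota>p[OF xA] \<iota>q[OF xA] x A[OF xA] by auto
  moreover have "\<iota> x \<in> K" using \<iota>A[OF xA] by (simp add: annulus_def)
  ultimately show ?thesis by blast
qed

end

section \<open>Measurability and bounds for Caratheodory nonlinearities and kernels\<close>

lemma leb01_measurable_cong_AE:
  fixes h h' :: "real \<Rightarrow> real"
  assumes "h \<in> borel_measurable leb01" and "AE x in leb01. h x = h' x"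
  shows "h' \<in> borel_measurable leb01"
proof -
  have "(\<lambda>x. if x \<in> {0..1} then h x else 0) \<in> borel_measurable lebesgue"
    using assms(1) by (subst borel_measurable_if) auto
  moreover have "AE x in lebesgue. (if x \<in> {0..1} then h x else 0) = (if x \<in> {0..1} then h' x else 0)"
    using assms(2) by (subst (asm) AE_restrict_space_iff) auto
  ultimately have "(\<lambda>x. if x \<in> {0..1} then h' x else 0) \<in> borel_measurable lebesgue"
    by (rule borel_measurable_AE)
  then show ?thesis by (subst (asm) borel_measurable_if) auto
qed

lemma leb01_measurable_LIMSEQ_AE:
  fixes F :: "nat \<Rightarrow> real \<Rightarrow> real"
  assumes F: "\<And>n. F n \<in> borel_measurable leb01" and lim: "AE x in leb01. (\<lambda>n. F n x) \<longlonglongrightarrow> h x"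
  shows "h \<in> borel_measurable leb01"
proof (rule leb01_measurable_cong_AE)
  show "(\<lambda>x. lim (\<lambda>n. F n x)) \<in> borel_measurable leb01"
    using F by (rule borel_measurable_lim_metric)
  show "AE x in leb01. lim (\<lambda>n. F n x) = h x"
    using lim by eventually_elim (rule limI)
qed

text \<open>
  The largest multiple of \<open>1 / (n + 1)\<close> that is at most \<open>u\<close>.
\<close>

definition grid_below :: "nat \<Rightarrow> real \<Rightarrow> real" where
  "grid_below n u = of_int \<lfloor>real (Suc n) * u\<rfloor> / real (Suc n)"

lemma grid_below_near: "\<bar>grid_below n u - u\<bar> \<le> 1 / real (Suc n)"
proof -
  have "grid_below n u - u = (of_int \<lfloor>real (Suc n) * u\<rfloor> - real (Suc n) * u) / real (Suc n)"
    by (simp add: grid_below_def field_simps)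
  moreover have "\<bar>of_int \<lfloor>real (Suc n) * u\<rfloor> - real (Suc n) * u\<bar> \<le> 1" by linarith
  ultimately show ?thesis by (simp add: divide_right_mono del: of_nat_Suc)
qed

lemma grid_below_tendsto: "(\<lambda>n. grid_below n u) \<longlonglongrightarrow> u"
proof -
  have "(\<lambda>n. grid_below n u - u) \<longlonglongrightarrow> 0"
    by (rule tendsto_0_le[OF LIMSEQ_inverse_real_of_nat, of _ 1])
      (use grid_below_near in \<open>simp add: inverse_eq_divide\<close>)
  then show ?thesis by (simp add: LIM_zero_iff)
qed

lemma continuous_pair_LIMSEQ:
  assumes "continuous_on UNIV (\<lambda>(u, v). F u v :: real)" "(U :: nat \<Rightarrow> real) \<longlonglongrightarrow> u" "(V :: nat \<Rightarrow> real) \<longlonglongrightarrow> v"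
  shows "(\<lambda>n. F (U n) (V n)) \<longlonglongrightarrow> F u v"
  using continuous_on_tendsto_compose[OF assms(1) tendsto_Pair[OF assms(2,3)]] by simp

text \<open>
  Replacing \<open>u\<close> and \<open>v\<close> by their grid values leaves countably many cases, each measurable
  by assumption; continuity of \<open>f s\<close> at almost every \<open>s\<close> carries measurability to the limit.
\<close>

lemma superposition_measurable:
  assumes f: "caratheodory f" and u: "u \<in> borel_measurable leb01" and v: "v \<in> borel_measurable leb01"
  shows "(\<lambda>s. f s (u s) (v s)) \<in> borel_measurable leb01"
proof (rule leb01_measurable_LIMSEQ_AE)
  fix n
  have m: "(\<lambda>s. \<lfloor>real (Suc n) * w s\<rfloor>) \<in> measurable leb01 (count_space UNIV)"
    if "w \<in> borel_measurable leb01" for w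
    using that by measurable
  have *: "(\<lambda>s. f s (of_int i / real (Suc n)) (of_int \<lfloor>real (Suc n) * v s\<rfloor> / real (Suc n))) \<in> borel_measurable leb01" for i
    using f by (intro measurable_compose_countable[OF _ m[OF v], where f="\<lambda>j s. f s (of_int i / real (Suc n)) (of_int j / real (Suc n))"])
      (auto simp: caratheodory_def)
  show "(\<lambda>s. f s (grid_below n (u s)) (grid_below n (v s))) \<in> borel_measurable leb01"
    unfolding grid_below_def
    by (rule measurable_compose_countable[OF * m[OF u]])
next
  have "AE t in leb01. continuous_on UNIV (\<lambda>(u, v). f t u v)" using f by (simp add: caratheodory_def)
  then show "AE s in leb01. (\<lambda>n. f s (grid_below n (u s)) (grid_below n (v s))) \<longlonglongrightarrow> f s (u s) (v s)"
    by eventually_elim (rule continuous_pair_LIMSEQ[OF _ grid_below_tendsto grid_below_tendsto])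
qed

text \<open>
  The Caratheodory bound has an exceptional null set for every pair \<open>(u, v)\<close>. Countably many
  pairs suffice to get a common null set, by continuity in \<open>(u, v)\<close>; grid points approximating the box
  of radius \<open>R\<close> may leave it, so the bound for radius \<open>R + 1\<close> is used.
\<close>

lemma caratheodory_bounded:
  assumes f: "caratheodory f" and R: "0 < R"
  obtains B where "0 \<le> B" "AE s in leb01. \<forall>u v. \<bar>u\<bar> \<le> R \<longrightarrow> \<bar>v\<bar> \<le> R \<longrightarrow> f s u v \<le> B"
proof -
  have "\<exists>\<phi>\<in>Linfty01. \<forall>u\<in>{-(R+1)..R+1}. \<forall>v\<in>{-(R+1)..R+1}. AE t in leb01. f t u v \<le> \<phi> t"
  proof -
    have "0 < R + 1" using R by simp
    with f show ?thesis unfolding caratheodory_def by blast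
  qed
  then obtain \<phi> where \<phi>: "\<phi> \<in> Linfty01" and le: "\<And>u v. \<bar>u\<bar> \<le> R + 1 \<Longrightarrow> \<bar>v\<bar> \<le> R + 1 \<Longrightarrow> AE t in leb01. f t u v \<le> \<phi> t"
    by (auto simp: abs_le_iff)
  obtain B where B: "AE t in leb01. \<bar>\<phi> t\<bar> \<le> B" using \<phi> by (auto simp: Linfty01_def)
  have AEg: "AE t in leb01. \<forall>n i j. \<bar>of_int i / real (Suc n)\<bar> \<le> R + 1 \<longrightarrow> \<bar>of_int j / real (Suc n)\<bar> \<le> R + 1 \<longrightarrow>
      f t (of_int i / real (Suc n)) (of_int j / real (Suc n)) \<le> \<phi> t"
    unfolding AE_all_countable
  proof (intro allI)
    fix n and i j :: int
    show "AE t in leb01. \<bar>of_int i / real (Suc n)\<bar> \<le> R + 1 \<longrightarrow> \<bar>of_int j / real (Suc n)\<bar> \<le> R + 1 \<longrightarrow>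
      f t (of_int i / real (Suc n)) (of_int j / real (Suc n)) \<le> \<phi> t"
      using le[of "of_int i / real (Suc n)" "of_int j / real (Suc n)"]
      by (cases "\<bar>of_int i / real (Suc n)\<bar> \<le> R + 1 \<and> \<bar>of_int j / real (Suc n)\<bar> \<le> R + 1") auto
  qed
  have "AE t in leb01. continuous_on UNIV (\<lambda>(u, v). f t u v)" using f by (simp add: caratheodory_def)
  with AEg B have "AE s in leb01. \<forall>u v. \<bar>u\<bar> \<le> R \<longrightarrow> \<bar>v\<bar> \<le> R \<longrightarrow> f s u v \<le> max 0 B"
  proof eventually_elim
    case (elim s)
    show ?case
    proof (intro allI impI)
      fix u v assume uv: "\<bar>u\<bar> \<le> R" "\<bar>v\<bar> \<le> R"
      have in1: "\<bar>grid_below n w\<bar> \<le> R + 1" if "\<bar>w\<bar> \<le> R" for n w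
      proof -
        have "1 / real (Suc n) \<le> 1" by simp
        then show ?thesis using grid_below_near[of n w] that by linarith
      qed
      have "f s (grid_below n u) (grid_below n v) \<le> max 0 B" for n
      proof -
        have "f s (grid_below n u) (grid_below n v) \<le> \<phi> s"
          using elim(1) in1[OF uv(1), of n] in1[OF uv(2), of n] unfolding grid_below_def by blast
        then show ?thesis using elim(2) by linarith
      qed
      then show "f s u v \<le> max 0 B"
        by (intro LIMSEQ_le_const2[OF continuous_pair_LIMSEQ[OF elim(3) grid_below_tendsto grid_below_tendsto]]) auto
    qed
  qed
  then show ?thesis using that[of "max 0 B"] by simp
qed

lemma AE_leb01_dense:
  assumes ae: "AE t in leb01. P t" and \<tau>: "\<tau> \<in> {0..1}"
  obtains X :: "nat \<Rightarrow> real" where "\<And>n. X n \<in> {0..1} - {\<tau>}" "\<And>n. P (X n)" "X \<longlonglongrightarrow> \<tau>"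
proof -
  have "\<exists>x. x \<in> {0..1} - {\<tau>} \<and> P x \<and> \<bar>x - \<tau>\<bar> \<le> 1 / real (Suc n)" for n
  proof (rule ccontr)
    assume no: "\<not> ?thesis"
    define d where "d = 1 / real (Suc n) / 2"
    have d: "0 < d" "2 * d \<le> 1" "d \<le> 1 / real (Suc n)" by (auto simp: d_def field_simps)
    define l where "l = (if \<tau> \<le> 1/2 then \<tau> else \<tau> - d)"
    have sub: "{l<..<l+d} \<subseteq> {0..1} - {\<tau>}" "\<And>x. x \<in> {l<..<l+d} \<Longrightarrow> \<bar>x - \<tau>\<bar> \<le> 1 / real (Suc n)"
      using d \<tau> by (auto simp: l_def split: if_splits)
    have "AE t in lebesgue. t \<in> {0..1} \<longrightarrow> P t"
      using ae by (subst (asm) AE_restrict_space_iff) auto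
    then have "AE t in lebesgue. t \<notin> {l<..<l+d}"
      by eventually_elim (use sub no in blast)
    then have "{l<..<l+d} \<in> null_sets lebesgue"
      by (subst AE_iff_null_sets[of _ lebesgue]) auto
    then show False using d open_not_negligible[of "{l<..<l+d}"] by (simp add: negligible_iff_null_sets)
  qed
  then obtain X where X: "\<And>n. X n \<in> {0..1} - {\<tau>}" "\<And>n. P (X n)" and near: "\<And>n. \<bar>X n - \<tau>\<bar> \<le> 1 / real (Suc n)"
    by metis
  have "(\<lambda>n. X n - \<tau>) \<longlonglongrightarrow> 0"
    by (rule tendsto_0_le[OF LIMSEQ_inverse_real_of_nat, of _ 1])
      (use near in \<open>simp add: inverse_eq_divide\<close>)
  then have "X \<longlonglongrightarrow> \<tau>" by (simp add: LIM_zero_iff)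
  with X show ?thesis by (rule that)
qed

text \<open>
  A Lebesgue measurable function on the square agrees almost everywhere with a Borel function,
  whose sections are all measurable; by Fubini almost all sections agree almost everywhere.
\<close>

lemma AE_section_measurable:
  fixes k :: "real \<Rightarrow> real \<Rightarrow> real"
  assumes k: "(\<lambda>(t, s). k t s) \<in> borel_measurable (lebesgue_on ({0..1} \<times> {0..1}))"
  shows "AE t in leb01. k t \<in> borel_measurable leb01"
proof -
  define k0 where "k0 = (\<lambda>x. if x \<in> {0..1} \<times> {0..1} then (\<lambda>(t, s). k t s) x else 0)"
  have box: "{0..1} \<times> {0..1} \<in> sets (lebesgue :: (real \<times> real) measure)"
    by (intro sets_completionI_sets) (simp add: borel_closed closed_Times)
  have "k0 \<in> borel_measurable lebesgue"
    unfolding k0_def using k box by (subst borel_measurable_if) auto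
  then obtain k1 where k1: "k1 \<in> borel_measurable lborel" and eq: "AE x in lborel. k0 x = k1 x"
    using completion_ex_borel_measurable_real by blast
  have "AE x in lborel \<Otimes>\<^sub>M lborel. k0 x = k1 x" unfolding lborel_prod by (rule eq)
  then have "AE t in lborel. AE s in lborel. k0 (t, s) = k1 (t, s)"
    by (rule lborel_pair.AE_pair)
  then have "AE t in lebesgue. AE s in lborel. k0 (t, s) = k1 (t, s)"
    by (rule AE_completion)
  then have "AE t in leb01. AE s in lborel. k0 (t, s) = k1 (t, s)"
    by (subst AE_restrict_space_iff) (auto elim: eventually_mono)
  then show ?thesis
    using AE_space
  proof eventually_elim
    case (elim t)
    have "AE s in lebesgue. k0 (t, s) = k1 (t, s)" using elim(1) by (rule AE_completion)
    then have "AE s in leb01. k0 (t, s) = k1 (t, s)"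
      by (subst AE_restrict_space_iff) (auto elim: eventually_mono)
    moreover have "AE s in leb01. s \<in> {0..1}" using AE_space[of leb01] by simp
    ultimately have ae: "AE s in leb01. k1 (t, s) = k t s"
      by eventually_elim (use elim(2) in \<open>simp add: k0_def\<close>)
    have "(\<lambda>s. k1 (t, s)) \<in> borel_measurable borel" using k1 by measurable
    then have "(\<lambda>s. k1 (t, s)) \<in> borel_measurable lebesgue" by (simp add: measurable_completion)
    then have "(\<lambda>s. k1 (t, s)) \<in> borel_measurable leb01" by (rule measurable_restrict_space1)
    then show ?case using ae by (rule leb01_measurable_cong_AE)
  qed
qed

section \<open>The Hammerstein operator of one equation\<close>

lemma integrable_real_bound:
  fixes F G :: "'a \<Rightarrow> real"
  assumes "integrable M G" "F \<in> borel_measurable M" "AE x in M. \<bar>F x\<bar> \<le> G x"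
  shows "integrable M F"
  using assms(1,2) by (rule Bochner_Integration.integrable_bound) (use assms(3) in \<open>auto elim: eventually_mono\<close>)

locale hammerstein_operator =
  fixes f :: "real \<Rightarrow> real \<Rightarrow> real \<Rightarrow> real" and k :: "real \<Rightarrow> real \<Rightarrow> real"
    and g \<Phi> :: "real \<Rightarrow> real" and a b c :: real
  assumes std: "standing_assumptions f k g \<Phi> a b c"
begin

text \<open>
  The Hammerstein operator as a linear operator in the source term \<open>h\<close>, which will be
  \<open>f s (u s) (v s)\<close>; the assumptions on the nonlinearity enter only through bounds on \<open>h\<close>.
\<close>

definition kernel_op :: "(real \<Rightarrow> real) \<Rightarrow> real \<Rightarrow> real" where
  "kernel_op h t = (LINT s|leb01. k t s * g s * h s)"

definition admissible :: "real \<Rightarrow> (real \<Rightarrow> real) \<Rightarrow> bool" where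
  "admissible B h \<longleftrightarrow> h \<in> borel_measurable leb01 \<and> (AE s in leb01. 0 \<le> h s \<and> h s \<le> B)"

lemma ab: "0 \<le> a" "a \<le> b" "b \<le> 1" and c: "0 < c" "c \<le> 1"
  and f_nonneg: "\<And>t u v. t \<in> {0..1} \<Longrightarrow> 0 \<le> f t u v"
  and f_car: "caratheodory f"
  and g_meas [measurable]: "g \<in> borel_measurable leb01"
  and g_nonneg: "AE s in leb01. 0 \<le> g s"
  and g\<Phi>: "integrable leb01 (\<lambda>s. g s * \<Phi> s)"
  and k_le: "\<And>t. t \<in> {0..1} \<Longrightarrow> AE s in leb01. \<bar>k t s\<bar> \<le> \<Phi> s"
  and k_ge: "\<And>t. t \<in> {a..b} \<Longrightarrow> AE s in leb01. c * \<Phi> s \<le> k t s"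
  and \<Phi>g_pos: "0 < (LINT s|lebesgue_on {a..b}. \<Phi> s * g s)"
  and k_lim: "\<And>\<tau>. \<tau> \<in> {0..1} \<Longrightarrow> AE s in leb01. ((\<lambda>t. \<bar>k t s - k \<tau> s\<bar>) \<longlongrightarrow> 0) (at \<tau> within {0..1})"
  and \<Phi>_meas [measurable]: "\<Phi> \<in> borel_measurable leb01"
proof -
  note S = std[unfolded standing_assumptions_def]
  show "0 \<le> a" "a \<le> b" "b \<le> 1" "0 < c" "c \<le> 1" "caratheodory f" "g \<in> borel_measurable leb01"
    "AE s in leb01. 0 \<le> g s" "integrable leb01 (\<lambda>s. g s * \<Phi> s)"
    "0 < (LINT s|lebesgue_on {a..b}. \<Phi> s * g s)"
    using S by blast+
  show "\<Phi> \<in> borel_measurable leb01" using S unfolding Linfty01_def by blast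
  show "0 \<le> f t u v" if "t \<in> {0..1}" for t u v using S that by blast
  show "AE s in leb01. \<bar>k t s\<bar> \<le> \<Phi> s" if "t \<in> {0..1}" for t using S that by blast
  show "AE s in leb01. c * \<Phi> s \<le> k t s" if "t \<in> {a..b}" for t using S that by blast
  show "AE s in leb01. ((\<lambda>t. \<bar>k t s - k \<tau> s\<bar>) \<longlongrightarrow> 0) (at \<tau> within {0..1})" if "\<tau> \<in> {0..1}" for \<tau>
    using S that by blast
qed

lemma admissibleD:
  assumes "admissible B h"
  shows "h \<in> borel_measurable leb01" "AE s in leb01. 0 \<le> h s \<and> h s \<le> B"
  using assms unfolding admissible_def by blast+

lemma ab_subset: "{a..b} \<subseteq> {0..1}" using ab by auto

lemma k_LIMSEQ:
  assumes "\<tau> \<in> {0..1}" "\<And>n. X n \<in> {0..1}" "X \<longlonglongrightarrow> \<tau>"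
  shows "AE s in leb01. (\<lambda>n. k (X n) s) \<longlonglongrightarrow> k \<tau> s"
  using k_lim[OF assms(1)]
proof eventually_elim
  case (elim s)
  have "((\<lambda>t. \<bar>k t s - k \<tau> s\<bar>) \<longlongrightarrow> \<bar>k \<tau> s - k \<tau> s\<bar>) (at \<tau> within {0..1})" using elim by simp
  then have "continuous (at \<tau> within {0..1}) (\<lambda>t. \<bar>k t s - k \<tau> s\<bar>)"
    by (simp add: continuous_within)
  then have "(\<lambda>n. \<bar>k (X n) s - k \<tau> s\<bar>) \<longlonglongrightarrow> \<bar>k \<tau> s - k \<tau> s\<bar>"
    using assms(2,3) unfolding continuous_within_sequentially by (auto simp: o_def)
  then show ?case using LIM_zero_cancel tendsto_rabs_zero_cancel by force
qed

text \<open>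
  Joint measurability alone gives only almost all sections. Every other section is an almost
  everywhere limit of measurable ones, by the continuity assumption on the first argument of \<open>k\<close>.
\<close>

lemma k_meas [measurable]:
  assumes "t \<in> {0..1}" shows "k t \<in> borel_measurable leb01"
proof -
  have "AE t in leb01. k t \<in> borel_measurable leb01"
    using std unfolding standing_assumptions_def by (intro AE_section_measurable) auto
  then obtain X where "\<And>n. X n \<in> {0..1} - {t}" "\<And>n. k (X n) \<in> borel_measurable leb01" "X \<longlonglongrightarrow> t"
    using AE_leb01_dense assms by blast
  then show ?thesis
    by (intro leb01_measurable_LIMSEQ_AE[OF _ k_LIMSEQ[OF assms]]) auto
qed

lemma kernel_bounds:
  assumes t: "t \<in> {0..1}" and h: "admissible B h"
  shows "AE s in leb01. \<bar>k t s * g s * h s\<bar> \<le> \<Phi> s * g s * h s \<and> \<Phi> s * g s * h s \<le> B * (g s * \<Phi> s)"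
proof -
  have "AE s in leb01. 0 \<le> h s \<and> h s \<le> B" using h by (rule admissibleD)
  with k_le[OF t] g_nonneg show ?thesis
  proof eventually_elim
    case (elim s)
    have \<Phi>: "0 \<le> \<Phi> s" using elim(1) by linarith
    have "\<bar>k t s * g s * h s\<bar> = \<bar>k t s\<bar> * (g s * h s)" using elim by (simp add: abs_mult)
    also have "\<dots> \<le> \<Phi> s * (g s * h s)" using elim by (intro mult_right_mono) auto
    finally have 1: "\<bar>k t s * g s * h s\<bar> \<le> \<Phi> s * g s * h s" by (simp add: mult.assoc)
    have "(g s * \<Phi> s) * h s \<le> (g s * \<Phi> s) * B" using elim \<Phi> by (intro mult_left_mono) auto
    with 1 show ?case by (simp add: mult_ac)
  qed
qed

lemma \<Phi>gh_integrable:
  assumes h: "admissible B h"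
  shows "integrable leb01 (\<lambda>s. \<Phi> s * g s * h s)"
proof (rule integrable_real_bound)
  show "integrable leb01 (\<lambda>s. B * (g s * \<Phi> s))" using g\<Phi> by simp
  show "(\<lambda>s. \<Phi> s * g s * h s) \<in> borel_measurable leb01" using h by (auto simp: admissible_def)
  show "AE s in leb01. \<bar>\<Phi> s * g s * h s\<bar> \<le> B * (g s * \<Phi> s)"
    using kernel_bounds[OF _ h, of 0] by (auto elim: eventually_mono)
qed

lemma kgh_integrable:
  assumes t: "t \<in> {0..1}" and h: "admissible B h"
  shows "integrable leb01 (\<lambda>s. k t s * g s * h s)"
proof (rule integrable_real_bound[OF \<Phi>gh_integrable[OF h]])
  show "(\<lambda>s. k t s * g s * h s) \<in> borel_measurable leb01" using h k_meas[OF t] by (auto simp: admissible_def)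
  show "AE s in leb01. \<bar>k t s * g s * h s\<bar> \<le> \<Phi> s * g s * h s"
    using kernel_bounds[OF t h] by (auto elim: eventually_mono)
qed

lemma kernel_op_abs_le:
  assumes t: "t \<in> {0..1}" and h: "admissible B h"
  shows "\<bar>kernel_op h t\<bar> \<le> (LINT s|leb01. \<Phi> s * g s * h s)"
proof -
  have "\<bar>kernel_op h t\<bar> \<le> (LINT s|leb01. \<bar>k t s * g s * h s\<bar>)"
    unfolding kernel_op_def by (rule integral_abs_bound)
  also have "\<dots> \<le> (LINT s|leb01. \<Phi> s * g s * h s)"
    using kernel_bounds[OF t h] by (intro integral_mono_AE integrable_abs kgh_integrable[OF t h] \<Phi>gh_integrable[OF h])
      (auto elim: eventually_mono)
  finally show ?thesis .
qed

lemma kernel_op_bounded: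
  assumes t: "t \<in> {0..1}" and h: "admissible B h"
  shows "\<bar>kernel_op h t\<bar> \<le> B * (LINT s|leb01. g s * \<Phi> s)"
proof -
  have "(LINT s|leb01. \<Phi> s * g s * h s) \<le> (LINT s|leb01. B * (g s * \<Phi> s))"
    using kernel_bounds[OF t h] g\<Phi> by (intro integral_mono_AE \<Phi>gh_integrable[OF h])
      (auto elim: eventually_mono)
  with kernel_op_abs_le[OF t h] show ?thesis by simp
qed

text \<open>
  Together with \<open>kernel_op_abs_le\<close> this is the reason why the operator maps into the cone: the
  same integral bounds the image from above everywhere and, up to the factor \<open>c\<close>, from below on \<open>[a, b]\<close>.
\<close>

lemma kernel_op_ge:
  assumes t: "t \<in> {a..b}" and h: "admissible B h"
  shows "c * (LINT s|leb01. \<Phi> s * g s * h s) \<le> kernel_op h t"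
proof -
  have t01: "t \<in> {0..1}" using t ab_subset by auto
  have "c * (LINT s|leb01. \<Phi> s * g s * h s) = (LINT s|leb01. c * (\<Phi> s * g s * h s))" by simp
  also have "\<dots> \<le> kernel_op h t"
    unfolding kernel_op_def
  proof (intro integral_mono_AE kgh_integrable[OF t01 h] integrable_mult_right \<Phi>gh_integrable[OF h])
    have "AE s in leb01. 0 \<le> h s \<and> h s \<le> B" using h by (rule admissibleD)
    with k_ge[OF t] g_nonneg show "AE s in leb01. c * (\<Phi> s * g s * h s) \<le> k t s * g s * h s"
    proof eventually_elim
      case (elim s)
      have "(c * \<Phi> s) * (g s * h s) \<le> k t s * (g s * h s)"
        using elim by (intro mult_right_mono) auto
      then show ?case by (simp add: mult_ac)
    qed
  qed
  finally show ?thesis .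
qed

lemma kernel_op_cone:
  assumes t: "t \<in> {a..b}" and \<tau>: "\<tau> \<in> {0..1}" and h: "admissible B h"
  shows "c * \<bar>kernel_op h \<tau>\<bar> \<le> kernel_op h t"
proof -
  have "c * \<bar>kernel_op h \<tau>\<bar> \<le> c * (LINT s|leb01. \<Phi> s * g s * h s)"
    using kernel_op_abs_le[OF \<tau> h] c by (intro mult_left_mono) auto
  then show ?thesis using kernel_op_ge[OF t h] by (rule order_trans)
qed

lemma kernel_L1_LIMSEQ:
  assumes \<tau>: "\<tau> \<in> {0..1}" and X: "\<And>n. X n \<in> {0..1}" "X \<longlonglongrightarrow> \<tau>"
  shows "(\<lambda>n. LINT s|leb01. \<bar>k (X n) s - k \<tau> s\<bar> * g s) \<longlonglongrightarrow> 0"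
proof -
  have "(\<lambda>n. LINT s|leb01. \<bar>k (X n) s - k \<tau> s\<bar> * g s) \<longlonglongrightarrow> (LINT s|leb01. 0)"
  proof (rule integral_dominated_convergence[where w = "\<lambda>s. 2 * (g s * \<Phi> s)"])
    show "(\<lambda>s. 0) \<in> borel_measurable leb01" by simp
    show "(\<lambda>s. \<bar>k (X n) s - k \<tau> s\<bar> * g s) \<in> borel_measurable leb01" for n
      using k_meas[OF X(1)[of n]] k_meas[OF \<tau>] by measurable
    show "integrable leb01 (\<lambda>s. 2 * (g s * \<Phi> s))" using g\<Phi> by simp
    show "AE s in leb01. (\<lambda>n. \<bar>k (X n) s - k \<tau> s\<bar> * g s) \<longlonglongrightarrow> 0"
      using k_LIMSEQ[OF \<tau> X]
    proof eventually_elim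
      case (elim s)
      have "(\<lambda>n. \<bar>k (X n) s - k \<tau> s\<bar> * g s) \<longlonglongrightarrow> \<bar>k \<tau> s - k \<tau> s\<bar> * g s"
        by (intro tendsto_intros elim)
      then show ?case by simp
    qed
    show "AE s in leb01. norm (\<bar>k (X n) s - k \<tau> s\<bar> * g s) \<le> 2 * (g s * \<Phi> s)" for n
      using k_le[OF X(1)[of n]] k_le[OF \<tau>] g_nonneg
    proof eventually_elim
      case (elim s)
      have "\<bar>k (X n) s - k \<tau> s\<bar> * g s \<le> (2 * \<Phi> s) * g s"
        using elim by (intro mult_right_mono) linarith+
      then show ?case using elim by (simp add: abs_mult mult_ac)
    qed
  qed
  then show ?thesis by simp
qed

lemma kernel_op_diff_le:
  assumes t: "t \<in> {0..1}" and \<tau>: "\<tau> \<in> {0..1}" and h: "admissible B h"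
  shows "\<bar>kernel_op h t - kernel_op h \<tau>\<bar> \<le> B * (LINT s|leb01. \<bar>k t s - k \<tau> s\<bar> * g s)"
proof -
  have g1: "admissible 1 (\<lambda>_. 1)" by (simp add: admissible_def)
  have int: "integrable leb01 (\<lambda>s. \<bar>k t s - k \<tau> s\<bar> * g s)"
  proof (rule integrable_real_bound[of _ "\<lambda>s. 2 * (g s * \<Phi> s)"])
    show "(\<lambda>s. \<bar>k t s - k \<tau> s\<bar> * g s) \<in> borel_measurable leb01"
      using k_meas[OF t] k_meas[OF \<tau>] by measurable
    show "AE s in leb01. \<bar>\<bar>k t s - k \<tau> s\<bar> * g s\<bar> \<le> 2 * (g s * \<Phi> s)"
      using k_le[OF t] k_le[OF \<tau>] g_nonneg
    proof eventually_elim
      case (elim s)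
      have "\<bar>k t s - k \<tau> s\<bar> * g s \<le> (2 * \<Phi> s) * g s"
        using elim by (intro mult_right_mono) linarith+
      then show ?case using elim by (simp add: abs_mult mult_ac)
    qed
  qed (use g\<Phi> in simp)
  have "kernel_op h t - kernel_op h \<tau> = (LINT s|leb01. k t s * g s * h s - k \<tau> s * g s * h s)"
    unfolding kernel_op_def by (rule Bochner_Integration.integral_diff[symmetric, OF kgh_integrable[OF t h] kgh_integrable[OF \<tau> h]])
  then have "\<bar>kernel_op h t - kernel_op h \<tau>\<bar> = \<bar>LINT s|leb01. k t s * g s * h s - k \<tau> s * g s * h s\<bar>" by (rule arg_cong)
  also have "\<dots> \<le> (LINT s|leb01. \<bar>k t s * g s * h s - k \<tau> s * g s * h s\<bar>)"
    by (rule integral_abs_bound)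
  also have "\<dots> \<le> (LINT s|leb01. B * (\<bar>k t s - k \<tau> s\<bar> * g s))"
  proof (rule integral_mono_AE)
    show "integrable leb01 (\<lambda>s. \<bar>k t s * g s * h s - k \<tau> s * g s * h s\<bar>)"
      by (intro integrable_abs Bochner_Integration.integrable_diff kgh_integrable[OF t h] kgh_integrable[OF \<tau> h])
    show "integrable leb01 (\<lambda>s. B * (\<bar>k t s - k \<tau> s\<bar> * g s))" using int by simp
    have "AE s in leb01. 0 \<le> h s \<and> h s \<le> B" using h by (rule admissibleD)
    with g_nonneg show "AE s in leb01. \<bar>k t s * g s * h s - k \<tau> s * g s * h s\<bar> \<le> B * (\<bar>k t s - k \<tau> s\<bar> * g s)"
    proof eventually_elim
      case (elim s)
      have "k t s * g s * h s - k \<tau> s * g s * h s = (k t s - k \<tau> s) * g s * h s" by (simp add: algebra_simps)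
      then have "\<bar>k t s * g s * h s - k \<tau> s * g s * h s\<bar> = \<bar>k t s - k \<tau> s\<bar> * g s * h s"
        using elim by (simp add: abs_mult)
      also have "\<dots> \<le> \<bar>k t s - k \<tau> s\<bar> * g s * B" using elim by (intro mult_left_mono) auto
      finally show ?case by (simp add: mult_ac)
    qed
  qed
  finally show ?thesis by simp
qed

text \<open>
  \<open>d\<close> does not depend on \<open>h\<close>, because the modulus of continuity is that of \<open>t \<mapsto> k t\<close> as a
  map into the integrable functions weighted by \<open>g\<close>.
\<close>

lemma kernel_op_equicontinuous:
  assumes \<tau>: "\<tau> \<in> {0..1}" and e: "0 < e"
  shows "\<exists>d>0. \<forall>t\<in>{0..1}. \<bar>t - \<tau>\<bar> < d \<longrightarrow> (\<forall>h. admissible B h \<longrightarrow> \<bar>kernel_op h t - kernel_op h \<tau>\<bar> < e)"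
proof -
  define \<omega> where "\<omega> t = \<bar>B\<bar> * (LINT s|leb01. \<bar>k t s - k \<tau> s\<bar> * g s)" for t
  have "continuous (at \<tau> within {0..1}) \<omega>"
    unfolding continuous_within_sequentially
  proof (intro allI impI)
    fix X assume "(\<forall>n. X n \<in> {0..1}) \<and> X \<longlonglongrightarrow> \<tau>"
    then have "(\<lambda>n. \<omega> (X n)) \<longlonglongrightarrow> \<bar>B\<bar> * 0"
      unfolding \<omega>_def by (intro tendsto_mult_left kernel_L1_LIMSEQ[OF \<tau>]) auto
    then show "(\<omega> \<circ> X) \<longlonglongrightarrow> \<omega> \<tau>" by (simp add: o_def \<omega>_def)
  qed
  then obtain d where d: "d > 0" "\<And>t. t \<in> {0..1} \<Longrightarrow> dist t \<tau> < d \<Longrightarrow> dist (\<omega> t) (\<omega> \<tau>) < e"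
    using e unfolding continuous_within_eps_delta by metis
  have "\<bar>kernel_op h t - kernel_op h \<tau>\<bar> < e" if t: "t \<in> {0..1}" "\<bar>t - \<tau>\<bar> < d" and h: "admissible B h" for h t
  proof -
    have "0 \<le> (LINT s|leb01. \<bar>k t s - k \<tau> s\<bar> * g s)"
      using g_nonneg by (intro integral_nonneg_AE) (auto elim: eventually_mono)
    then have "\<bar>kernel_op h t - kernel_op h \<tau>\<bar> \<le> \<omega> t"
      using kernel_op_diff_le[OF t(1) \<tau> h] mult_right_mono[OF abs_ge_self[of B]] unfolding \<omega>_def
      by (meson order_trans)
    moreover have "\<omega> t < e" using d(2)[OF t(1)] t(2) by (simp add: dist_real_def \<omega>_def)
    ultimately show ?thesis by simp
  qed
  with d(1) show ?thesis by blast
qed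

lemma kernel_op_continuous:
  assumes "admissible B h" shows "continuous_on {0..1} (kernel_op h)"
  unfolding continuous_on_iff
proof (intro ballI allI impI)
  fix \<tau> e :: real assume "\<tau> \<in> {0..1}" "0 < e"
  from kernel_op_equicontinuous[OF this, of B] assms
  show "\<exists>d>0. \<forall>t\<in>{0..1}. dist t \<tau> < d \<longrightarrow> dist (kernel_op h t) (kernel_op h \<tau>) < e"
    by (auto simp: dist_real_def)
qed

lemma kernel_op_uniform_limit:
  assumes H: "\<And>n. admissible B (H n)" and h: "admissible B h"
    and lim: "AE s in leb01. (\<lambda>n. H n s) \<longlonglongrightarrow> h s"
  shows "uniform_limit {0..1} (\<lambda>n. kernel_op (H n)) (kernel_op h) sequentially"
proof -
  have "(\<lambda>n. LINT s|leb01. \<Phi> s * g s * \<bar>H n s - h s\<bar>) \<longlonglongrightarrow> (LINT s|leb01. 0)"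
  proof (rule integral_dominated_convergence[where w = "\<lambda>s. B * (g s * \<Phi> s)"])
    show "(\<lambda>s. \<Phi> s * g s * \<bar>H n s - h s\<bar>) \<in> borel_measurable leb01" for n
      by (intro borel_measurable_times borel_measurable_abs borel_measurable_diff \<Phi>_meas g_meas admissibleD(1)[OF H] admissibleD(1)[OF h])
    show "integrable leb01 (\<lambda>s. B * (g s * \<Phi> s))" using g\<Phi> by simp
    show "AE s in leb01. (\<lambda>n. \<Phi> s * g s * \<bar>H n s - h s\<bar>) \<longlonglongrightarrow> 0"
      using lim
    proof eventually_elim
      case (elim s)
      have "(\<lambda>n. \<Phi> s * g s * \<bar>H n s - h s\<bar>) \<longlonglongrightarrow> \<Phi> s * g s * \<bar>h s - h s\<bar>"
        by (intro tendsto_intros elim)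
      then show ?case by simp
    qed
    show "AE s in leb01. norm (\<Phi> s * g s * \<bar>H n s - h s\<bar>) \<le> B * (g s * \<Phi> s)" for n
    proof -
      have "AE s in leb01. 0 \<le> H n s \<and> H n s \<le> B" "AE s in leb01. 0 \<le> h s \<and> h s \<le> B"
        by (rule admissibleD(2)[OF H], rule admissibleD(2)[OF h])
      with g_nonneg k_le[of 0, simplified] show ?thesis
      proof eventually_elim
        case (elim s)
        have "0 \<le> \<Phi> s * g s" using elim by simp
        moreover have "\<bar>H n s - h s\<bar> \<le> B" using elim by linarith
        ultimately have "\<Phi> s * g s * \<bar>H n s - h s\<bar> \<le> \<Phi> s * g s * B" by (rule mult_left_mono[rotated])
        moreover have "\<bar>\<Phi> s * g s * \<bar>H n s - h s\<bar>\<bar> = \<Phi> s * g s * \<bar>H n s - h s\<bar>"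
          by (rule abs_of_nonneg[OF mult_nonneg_nonneg[OF \<open>0 \<le> \<Phi> s * g s\<close> abs_ge_zero]])
        ultimately show ?case by (simp add: mult_ac)
      qed
    qed
  qed simp
  then have lim0: "(\<lambda>n. LINT s|leb01. \<Phi> s * g s * \<bar>H n s - h s\<bar>) \<longlonglongrightarrow> 0" by simp
  have bound: "\<bar>kernel_op (H n) t - kernel_op h t\<bar> \<le> (LINT s|leb01. \<Phi> s * g s * \<bar>H n s - h s\<bar>)" if t: "t \<in> {0..1}" for n t
  proof -
    have "kernel_op (H n) t - kernel_op h t = (LINT s|leb01. k t s * g s * H n s - k t s * g s * h s)"
      unfolding kernel_op_def by (rule Bochner_Integration.integral_diff[symmetric, OF kgh_integrable[OF t H] kgh_integrable[OF t h]])
    then have "\<bar>kernel_op (H n) t - kernel_op h t\<bar> = \<bar>LINT s|leb01. k t s * g s * H n s - k t s * g s * h s\<bar>" by (rule arg_cong)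
    also have "\<dots> \<le> (LINT s|leb01. \<bar>k t s * g s * H n s - k t s * g s * h s\<bar>)"
      by (rule integral_abs_bound)
    also have "\<dots> \<le> (LINT s|leb01. \<Phi> s * g s * \<bar>H n s - h s\<bar>)"
    proof (rule integral_mono_AE)
      show "integrable leb01 (\<lambda>s. \<bar>k t s * g s * H n s - k t s * g s * h s\<bar>)"
        by (intro integrable_abs Bochner_Integration.integrable_diff kgh_integrable[OF t h] kgh_integrable[OF t H])
      have d: "admissible B (\<lambda>s. \<bar>H n s - h s\<bar>)"
      proof -
        have "AE s in leb01. 0 \<le> H n s \<and> H n s \<le> B" "AE s in leb01. 0 \<le> h s \<and> h s \<le> B"
          by (rule admissibleD(2)[OF H], rule admissibleD(2)[OF h])
        then have "AE s in leb01. 0 \<le> \<bar>H n s - h s\<bar> \<and> \<bar>H n s - h s\<bar> \<le> B"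
          by eventually_elim linarith
        moreover have "(\<lambda>s. \<bar>H n s - h s\<bar>) \<in> borel_measurable leb01"
          by (intro borel_measurable_abs borel_measurable_diff admissibleD(1)[OF H] admissibleD(1)[OF h])
        ultimately show ?thesis by (simp add: admissible_def)
      qed
      show "integrable leb01 (\<lambda>s. \<Phi> s * g s * \<bar>H n s - h s\<bar>)" by (rule \<Phi>gh_integrable[OF d])
      show "AE s in leb01. \<bar>k t s * g s * H n s - k t s * g s * h s\<bar> \<le> \<Phi> s * g s * \<bar>H n s - h s\<bar>"
        using kernel_bounds[OF t d] g_nonneg
      proof eventually_elim
        case (elim s)
        have "k t s * g s * H n s - k t s * g s * h s = k t s * g s * (H n s - h s)" by (simp add: algebra_simps)
        then have "\<bar>k t s * g s * H n s - k t s * g s * h s\<bar> = \<bar>k t s * g s * \<bar>H n s - h s\<bar>\<bar>" by (simp add: abs_mult)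
        with elim show ?case by simp
      qed
    qed
    finally show ?thesis .
  qed
  show ?thesis
  proof (rule uniform_limitI)
    fix e :: real assume "0 < e"
    then have "\<forall>\<^sub>F n in sequentially. (LINT s|leb01. \<Phi> s * g s * \<bar>H n s - h s\<bar>) < e"
      using lim0 by (rule order_tendstoD(2)[rotated])
    then show "\<forall>\<^sub>F n in sequentially. \<forall>t\<in>{0..1}. dist (kernel_op (H n) t) (kernel_op h t) < e"
    proof eventually_elim
      case (elim n)
      show ?case
      proof
        fix t :: real assume "t \<in> {0..1}"
        from le_less_trans[OF bound[OF this] elim]
        show "dist (kernel_op (H n) t) (kernel_op h t) < e" by (simp add: dist_real_def)
      qed
    qed
  qed
qed

lemma admissible_indicator: "admissible 1 (indicator {a..b})"
proof -
  have "indicator {a..b} \<in> borel_measurable leb01"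
    using ab_subset by (intro borel_measurable_indicator) (auto simp: sets_restrict_space_iff)
  then show ?thesis by (auto simp: admissible_def split: split_indicator)
qed

text \<open>
  Integrals over the subinterval are integrals over \<open>[0, 1]\<close> with the indicator as source
  term, which makes the previous estimates applicable to the constant \<open>M\<close>.
\<close>

lemma integral_subinterval:
  fixes F :: "real \<Rightarrow> real"
  shows "(LINT s|lebesgue_on {a..b}. F s) = (LINT s|leb01. F s * indicator {a..b} s)"
proof -
  have "lebesgue_on {a..b} = restrict_space leb01 {a..b}"
    using ab_subset by (subst restrict_restrict_space) (auto simp: Int_absorb1)
  then show ?thesis
    using ab_subset by (simp add: integral_restrict_space sets_restrict_space_iff Int_absorb1 mult.commute)
qed

lemma integral_k_subinterval: "(LINT s|lebesgue_on {a..b}. k t s * g s) = kernel_op (indicator {a..b}) t"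
  by (simp add: integral_subinterval kernel_op_def)

text \<open>
  Positivity of the integral of \<open>\<Phi> g\<close> over the subinterval enters here; it makes the infimum
  defining \<open>M\<close> and the supremum defining \<open>m\<close> positive.
\<close>

lemma kernel_op_indicator_ge:
  obtains \<delta> where "0 < \<delta>" "\<And>t. t \<in> {a..b} \<Longrightarrow> \<delta> \<le> kernel_op (indicator {a..b}) t"
proof
  show "0 < c * (LINT s|lebesgue_on {a..b}. \<Phi> s * g s)" using c \<Phi>g_pos by simp
  show "c * (LINT s|lebesgue_on {a..b}. \<Phi> s * g s) \<le> kernel_op (indicator {a..b}) t" if "t \<in> {a..b}" for t
    unfolding integral_subinterval by (rule kernel_op_ge[OF that admissible_indicator])
qed

lemma abs_kg_integrable:
  assumes t: "t \<in> {0..1}"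
  shows "integrable leb01 (\<lambda>s. \<bar>k t s\<bar> * g s)" "(LINT s|leb01. \<bar>k t s\<bar> * g s) \<le> (LINT s|leb01. g s * \<Phi> s)"
proof -
  have le: "AE s in leb01. \<bar>k t s\<bar> * g s \<le> g s * \<Phi> s"
    using k_le[OF t] g_nonneg
  proof eventually_elim
    case (elim s)
    then have "\<bar>k t s\<bar> * g s \<le> \<Phi> s * g s" by (rule mult_right_mono)
    then show ?case by (simp add: mult.commute)
  qed
  show int: "integrable leb01 (\<lambda>s. \<bar>k t s\<bar> * g s)"
  proof (rule integrable_real_bound[OF g\<Phi>])
    show "(\<lambda>s. \<bar>k t s\<bar> * g s) \<in> borel_measurable leb01"
      by (intro borel_measurable_times borel_measurable_abs k_meas[OF t] g_meas)
    show "AE s in leb01. \<bar>\<bar>k t s\<bar> * g s\<bar> \<le> g s * \<Phi> s"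
      using le g_nonneg by eventually_elim (simp add: abs_mult)
  qed
  show "(LINT s|leb01. \<bar>k t s\<bar> * g s) \<le> (LINT s|leb01. g s * \<Phi> s)"
    by (rule integral_mono_AE[OF int g\<Phi> le])
qed

lemma kernel_op_abs_le_scaled:
  assumes t: "t \<in> {0..1}" and h: "admissible B h" and le: "AE s in leb01. h s \<le> C"
  shows "\<bar>kernel_op h t\<bar> \<le> C * (LINT s|leb01. \<bar>k t s\<bar> * g s)"
proof -
  have "\<bar>kernel_op h t\<bar> \<le> (LINT s|leb01. \<bar>k t s * g s * h s\<bar>)"
    unfolding kernel_op_def by (rule integral_abs_bound)
  also have "\<dots> \<le> (LINT s|leb01. C * (\<bar>k t s\<bar> * g s))"
  proof (rule integral_mono_AE)
    show "integrable leb01 (\<lambda>s. \<bar>k t s * g s * h s\<bar>)" by (intro integrable_abs kgh_integrable[OF t h])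
    show "integrable leb01 (\<lambda>s. C * (\<bar>k t s\<bar> * g s))" by (intro integrable_mult_right abs_kg_integrable[OF t])
    show "AE s in leb01. \<bar>k t s * g s * h s\<bar> \<le> C * (\<bar>k t s\<bar> * g s)"
      using g_nonneg admissibleD(2)[OF h] le
    proof eventually_elim
      case (elim s)
      have "\<bar>k t s * g s * h s\<bar> = \<bar>k t s\<bar> * g s * h s" using elim by (simp add: abs_mult)
      also have "\<dots> \<le> \<bar>k t s\<bar> * g s * C" using elim by (intro mult_left_mono) auto
      finally show ?case by (simp add: mult_ac)
    qed
  qed
  finally show ?thesis by simp
qed

lemma int_abs_k_le:
  assumes "t \<in> {0..1}"
  shows "(LINT s|leb01. \<bar>k t s\<bar> * g s) \<le> (SUP t\<in>{0..1}. LINT s|leb01. \<bar>k t s\<bar> * g s)"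
  by (rule cSUP_upper[OF assms bdd_aboveI2]) (rule abs_kg_integrable(2))

lemma m_const_inverse_pos: "0 < (SUP t\<in>{0..1}. LINT s|leb01. \<bar>k t s\<bar> * g s)"
proof -
  obtain \<delta> where \<delta>: "0 < \<delta>" "\<And>t. t \<in> {a..b} \<Longrightarrow> \<delta> \<le> kernel_op (indicator {a..b}) t" by (rule kernel_op_indicator_ge) blast
  have a: "a \<in> {0..1}" "a \<in> {a..b}" using ab by auto
  have "\<delta> \<le> \<bar>kernel_op (indicator {a..b}) a\<bar>" using \<delta>(2)[OF a(2)] by linarith
  also have "\<dots> \<le> 1 * (LINT s|leb01. \<bar>k a s\<bar> * g s)"
    by (rule kernel_op_abs_le_scaled[OF a(1) admissible_indicator]) (simp split: split_indicator)
  finally show ?thesis using int_abs_k_le[OF a(1)] \<delta>(1) by linarith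
qed

lemma M_const_inverse_pos: "0 < (INF t\<in>{a..b}. LINT s|lebesgue_on {a..b}. k t s * g s)"
  and int_k_ge: "t \<in> {a..b} \<Longrightarrow>
    (INF t\<in>{a..b}. LINT s|lebesgue_on {a..b}. k t s * g s) \<le> kernel_op (indicator {a..b}) t"
proof -
  obtain \<delta> where \<delta>: "0 < \<delta>" "\<And>t. t \<in> {a..b} \<Longrightarrow> \<delta> \<le> kernel_op (indicator {a..b}) t" by (rule kernel_op_indicator_ge) blast
  have "\<delta> \<le> (INF t\<in>{a..b}. kernel_op (indicator {a..b}) t)"
    using \<delta>(2) ab by (intro cINF_greatest) auto
  with \<delta>(1) show "0 < (INF t\<in>{a..b}. LINT s|lebesgue_on {a..b}. k t s * g s)"
    unfolding integral_k_subinterval by linarith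
  assume t: "t \<in> {a..b}"
  show "(INF t\<in>{a..b}. LINT s|lebesgue_on {a..b}. k t s * g s) \<le> kernel_op (indicator {a..b}) t"
    unfolding integral_k_subinterval by (rule cINF_lower[OF bdd_belowI2 t]) (rule \<delta>(2))
qed

text \<open>
  The bound \<open>r'\<close> is uniform in \<open>t\<close>, so that it passes to the supremum norm as a strict inequality;
  the same holds for the minimum in the next lemma.
\<close>

lemma kernel_op_less:
  assumes r: "0 < r" and \<mu>: "\<mu> < m_const k g" and h: "admissible B h"
    and le: "\<And>s. s \<in> {0..1} \<Longrightarrow> h s \<le> \<mu> * r"
  shows "\<exists>r'<r. \<forall>t\<in>{0..1}. \<bar>kernel_op h t\<bar> \<le> r'"
proof -
  define S where "S = (SUP t\<in>{0..1}. LINT s|leb01. \<bar>k t s\<bar> * g s)"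
  have S: "0 < S" unfolding S_def by (rule m_const_inverse_pos)
  define C where "C = max 0 \<mu> * r"
  have "max 0 \<mu> < 1 / S" using \<mu> S by (simp add: m_const_def S_def)
  then have "max 0 \<mu> * S < 1" using S by (simp add: pos_less_divide_eq)
  then have CS: "C * S < r" using r mult_strict_left_mono[of "max 0 \<mu> * S" 1 r] by (simp add: C_def mult_ac)
  have "\<bar>kernel_op h t\<bar> \<le> C * S" if t: "t \<in> {0..1}" for t
  proof -
    have "\<mu> * r \<le> C" unfolding C_def using r by (intro mult_right_mono) auto
    then have "AE s in leb01. h s \<le> C"
      using order_trans[OF le] by (intro AE_I2) simp
    from kernel_op_abs_le_scaled[OF t h this] have "\<bar>kernel_op h t\<bar> \<le> C * (LINT s|leb01. \<bar>k t s\<bar> * g s)" .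
    also have "\<dots> \<le> C * S" unfolding S_def
      by (intro mult_left_mono int_abs_k_le[OF t]) (use r in \<open>simp add: C_def\<close>)
    finally show ?thesis .
  qed
  with CS show ?thesis by blast
qed

lemma kernel_op_greater:
  assumes \<rho>: "0 < \<rho>" and \<mu>: "M_const k g a b < \<mu>" and h: "admissible B h"
    and ge: "\<And>s. s \<in> {a..b} \<Longrightarrow> \<mu> * \<rho> \<le> h s"
  shows "\<exists>r'>\<rho>. \<forall>t\<in>{a..b}. r' \<le> kernel_op h t"
proof -
  define J where "J = (INF t\<in>{a..b}. LINT s|lebesgue_on {a..b}. k t s * g s)"
  have J: "0 < J" unfolding J_def by (rule M_const_inverse_pos)
  have \<mu>J: "1 / J < \<mu>" using \<mu> by (simp add: M_const_def J_def)
  then have \<mu>0: "0 < \<mu>" using J by (meson divide_pos_pos less_trans zero_less_one)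
  have "1 < \<mu> * J" using \<mu>J J by (simp add: pos_divide_less_eq)
  then have gt: "\<rho> < \<mu> * \<rho> * J" using \<rho> mult_strict_left_mono[of 1 "\<mu> * J" \<rho>] by (simp add: mult_ac)
  have "\<mu> * \<rho> * J \<le> kernel_op h t" if t: "t \<in> {a..b}" for t
  proof -
    have t01: "t \<in> {0..1}" using t ab_subset by auto
    have "\<mu> * \<rho> * J \<le> \<mu> * \<rho> * kernel_op (indicator {a..b}) t"
      unfolding J_def using \<mu>0 \<rho> by (intro mult_left_mono int_k_ge[OF t]) auto
    also have "\<dots> = (LINT s|leb01. \<mu> * \<rho> * (k t s * g s * indicator {a..b} s))" by (simp add: kernel_op_def)
    also have "\<dots> \<le> kernel_op h t" unfolding kernel_op_def
    proof (intro integral_mono_AE integrable_mult_right kgh_integrable[OF t01 h] kgh_integrable[OF t01 admissible_indicator])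
      show "AE s in leb01. \<mu> * \<rho> * (k t s * g s * indicator {a..b} s) \<le> k t s * g s * h s"
        using k_ge[OF t] k_le[OF t01] g_nonneg admissibleD(2)[OF h]
      proof eventually_elim
        case (elim s)
        have "0 \<le> c * \<Phi> s" using elim(2) c by simp
        then have kg: "0 \<le> k t s * g s" using elim(1,3) by simp
        have "\<mu> * \<rho> * indicator {a..b} s \<le> h s" using ge[of s] elim(4) by (simp split: split_indicator)
        from mult_left_mono[OF this kg] show ?case by (simp add: mult_ac)
      qed
    qed
    finally show ?thesis .
  qed
  with gt show ?thesis by blast
qed

end

section \<open>The cone of continuous functions and complete continuity\<close>

lemma compact_closureI_subseq:
  fixes A :: "'a::metric_space set"
  assumes "\<And>x::nat \<Rightarrow> 'a. (\<And>n. x n \<in> A) \<Longrightarrow> \<exists>l r. strict_mono (r :: nat \<Rightarrow> nat) \<and> (\<lambda>n. x (r n)) \<longlonglongrightarrow> l"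
  shows "compact (closure A)"
  unfolding compact_eq_seq_compact_metric seq_compact_def
proof (intro allI impI)
  fix y :: "nat \<Rightarrow> 'a" assume "\<forall>n. y n \<in> closure A"
  then have "\<exists>x\<in>A. dist x (y n) < 1 / real (Suc n)" for n
    using closure_approachable[of "y n" A] by (metis of_nat_0_less_iff zero_less_Suc zero_less_divide_1_iff)
  then obtain x where xA: "\<And>n. x n \<in> A" and near: "\<And>n. dist (x n) (y n) < 1 / real (Suc n)" by metis
  obtain l r where r: "strict_mono (r :: nat \<Rightarrow> nat)" and lim: "(\<lambda>n. x (r n)) \<longlonglongrightarrow> l"
    using assms xA by blast
  have "(\<lambda>n. dist (x n) (y n)) \<longlonglongrightarrow> 0"
    by (rule tendsto_sandwich[OF _ _ tendsto_const LIMSEQ_inverse_real_of_nat])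
      (use near in \<open>auto simp: inverse_eq_divide less_imp_le\<close>)
  from LIMSEQ_subseq_LIMSEQ[OF this r] have "(\<lambda>n. dist (y (r n)) (x (r n))) \<longlonglongrightarrow> 0"
    by (simp add: o_def dist_commute)
  moreover have "(\<lambda>n. dist (x (r n)) l) \<longlonglongrightarrow> 0"
    using lim by (simp only: tendsto_dist_iff[symmetric])
  ultimately have sum0: "(\<lambda>n. dist (y (r n)) (x (r n)) + dist (x (r n)) l) \<longlonglongrightarrow> 0"
    by (rule tendsto_add_zero)
  have "(\<lambda>n. dist (y (r n)) l) \<longlonglongrightarrow> 0"
    by (rule tendsto_0_le[OF sum0, of _ 1]) (simp add: dist_triangle)
  then have "(\<lambda>n. y (r n)) \<longlonglongrightarrow> l" by (simp only: tendsto_dist_iff[symmetric])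
  moreover have "l \<in> closure A"
    using lim xA closure_sequential by (metis (no_types, lifting))
  ultimately show "\<exists>l\<in>closure A. \<exists>r. strict_mono r \<and> (y \<circ> r) \<longlonglongrightarrow> l"
    using r by (auto simp: o_def)
qed

text \<open>
  Elements of \<open>C[0,1]\<close> are represented by bounded continuous functions on the line that are
  constant on either side of \<open>[0,1]\<close>, i.e. invariant under this retraction. The supremum norm on
  \<open>[0,1]\<close> is then the norm of a complete normed space.
\<close>

definition clamp01 :: "real \<Rightarrow> real" where "clamp01 x = max 0 (min 1 x)"

lemma clamp01_in: "clamp01 x \<in> {0..1}" by (simp add: clamp01_def)

lemma clamp01_id: "x \<in> {0..1} \<Longrightarrow> clamp01 x = x" by (simp add: clamp01_def)

lemma clamp01_continuous: "continuous_on A clamp01"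
  unfolding clamp01_def by (intro continuous_intros)

lemma norm_bcontfun_leI:
  fixes w :: "real \<Rightarrow>\<^sub>C real"
  shows "(\<And>x. \<bar>w x\<bar> \<le> B) \<Longrightarrow> norm w \<le> B"
  using norm_bound[of w B] by simp

lemma abs_bcontfun_le_norm: "\<bar>apply_bcontfun w x\<bar> \<le> norm (w :: real \<Rightarrow>\<^sub>C real)"
  using norm_bounded[of w x] by simp

locale interval_cone =
  fixes a b c :: real
  assumes ab: "0 \<le> a" "a \<le> b" "b \<le> 1" and c: "0 < c" "c \<le> 1"
begin

text \<open>
  The pointwise form of the inequality between minimum and supremum norm is the one that passes
  directly to sums and limits.
\<close>

definition cone :: "(real \<Rightarrow>\<^sub>C real) set" where
  "cone = {w. (\<forall>x. apply_bcontfun w x = apply_bcontfun w (clamp01 x)) \<and> (\<forall>t\<in>{a..b}. \<forall>s\<in>{0..1}. c * \<bar>w s\<bar> \<le> w t)}"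

definition interval_min :: "(real \<Rightarrow>\<^sub>C real) \<Rightarrow> real" where
  "interval_min w = (INF t\<in>{a..b}. w t)"

lemma interval_min_le: "t \<in> {a..b} \<Longrightarrow> interval_min w \<le> w t"
  unfolding interval_min_def
proof (rule cINF_lower)
  show "bdd_below (apply_bcontfun w ` {a..b})"
  proof (rule bdd_belowI2)
    show "- norm w \<le> w x" for x using abs_bcontfun_le_norm[of w x] by linarith
  qed
qed

lemma interval_min_ge: "(\<And>t. t \<in> {a..b} \<Longrightarrow> m \<le> apply_bcontfun w t) \<Longrightarrow> m \<le> interval_min w"
  unfolding interval_min_def using ab by (intro cINF_greatest) auto

lemma interval_min_le_norm: "interval_min w \<le> norm w"
proof -
  have "interval_min w \<le> w a" using ab by (intro interval_min_le) simp
  also have "\<dots> \<le> norm w" using abs_bcontfun_le_norm[of w a] by linarith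
  finally show ?thesis .
qed

lemma coneD: assumes "w \<in> cone"
  shows "apply_bcontfun w x = apply_bcontfun w (clamp01 x)"
    and "t \<in> {a..b} \<Longrightarrow> s \<in> {0..1} \<Longrightarrow> c * \<bar>apply_bcontfun w s\<bar> \<le> apply_bcontfun w t"
  using assms unfolding cone_def by blast+

lemma norm_le_interval_min: assumes w: "w \<in> cone" shows "c * norm w \<le> interval_min w"
proof -
  have "\<bar>w x\<bar> \<le> interval_min w / c" for x
  proof -
    have "c * \<bar>w (clamp01 x)\<bar> \<le> interval_min w"
      by (rule interval_min_ge) (rule coneD(2)[OF w _ clamp01_in])
    then show ?thesis using c coneD(1)[OF w, of x] by (simp add: pos_le_divide_eq mult.commute)
  qed
  then have "norm w \<le> interval_min w / c" by (rule norm_bcontfun_leI)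
  then show ?thesis using c by (simp add: pos_le_divide_eq mult.commute)
qed

lemma interval_min_nonneg: "w \<in> cone \<Longrightarrow> 0 \<le> interval_min w"
  using norm_le_interval_min[of w] c by (meson less_imp_le mult_nonneg_nonneg norm_ge_zero order_trans)

lemma interval_min_scale: assumes s: "0 \<le> s" shows "interval_min (s *\<^sub>R w) = s * interval_min w"
proof (cases "s = 0")
  case True
  then show ?thesis using ab by (simp add: interval_min_def)
next
  case False
  then have s: "0 < s" using s by simp
  show ?thesis
  proof (rule antisym)
    have "interval_min (s *\<^sub>R w) / s \<le> interval_min w"
    proof (rule interval_min_ge)
      fix t assume "t \<in> {a..b}"
      from interval_min_le[OF this, of "s *\<^sub>R w"] show "interval_min (s *\<^sub>R w) / s \<le> w t"
        using s by (simp add: pos_divide_le_eq mult.commute)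
    qed
    then show "interval_min (s *\<^sub>R w) \<le> s * interval_min w" using s by (simp add: pos_divide_le_eq mult.commute)
    show "s * interval_min w \<le> interval_min (s *\<^sub>R w)"
    proof (rule interval_min_ge)
      fix t assume "t \<in> {a..b}"
      from mult_left_mono[OF interval_min_le[OF this, of w], of s] show "s * interval_min w \<le> (s *\<^sub>R w) t"
        using s by simp
    qed
  qed
qed

lemma interval_min_lipschitz: "interval_min u - interval_min v \<le> dist u v"
proof -
  have "interval_min u - dist u v \<le> interval_min v"
  proof (rule interval_min_ge)
    fix t assume "t \<in> {a..b}"
    from interval_min_le[OF this, of u] dist_bounded[of u t v] show "interval_min u - dist u v \<le> v t"
      unfolding dist_real_def by linarith
  qed
  then show ?thesis by simp
qed

lemma interval_min_continuous: "continuous_on A interval_min"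
  unfolding continuous_on_iff
proof (intro ballI allI impI)
  fix u and e :: real assume "0 < e"
  have "dist (interval_min v) (interval_min u) \<le> dist v u" for v
    using interval_min_lipschitz[of u v] interval_min_lipschitz[of v u] by (simp add: dist_real_def dist_commute)
  with \<open>0 < e\<close> show "\<exists>d>0. \<forall>v\<in>A. dist v u < d \<longrightarrow> dist (interval_min v) (interval_min u) < e"
    by (meson le_less_trans)
qed

lemma cone_add: assumes "u \<in> cone" "v \<in> cone" shows "u + v \<in> cone"
proof -
  have "apply_bcontfun (u + v) x = (u + v) (clamp01 x)" for x
    using coneD(1)[OF assms(1), of x] coneD(1)[OF assms(2), of x] by simp
  moreover have "c * \<bar>apply_bcontfun (u + v) s\<bar> \<le> (u + v) t" if "t \<in> {a..b}" "s \<in> {0..1}" for s t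
  proof -
    have "c * \<bar>u s + v s\<bar> \<le> c * (\<bar>u s\<bar> + \<bar>v s\<bar>)" using c by (intro mult_left_mono) auto
    then show ?thesis
      using coneD(2)[OF assms(1) that] coneD(2)[OF assms(2) that] by (simp add: distrib_left)
  qed
  ultimately show ?thesis unfolding cone_def by blast
qed

lemma cone_scale: assumes "0 \<le> l" "u \<in> cone" shows "l *\<^sub>R u \<in> cone"
proof -
  have "apply_bcontfun (l *\<^sub>R u) x = (l *\<^sub>R u) (clamp01 x)" for x
    using coneD(1)[OF assms(2), of x] by simp
  moreover have "c * \<bar>(l *\<^sub>R u) s\<bar> \<le> (l *\<^sub>R u) t" if "t \<in> {a..b}" "s \<in> {0..1}" for s t
    using mult_left_mono[OF coneD(2)[OF assms(2) that] assms(1)] assms(1) by (simp add: abs_mult mult_ac)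
  ultimately show ?thesis unfolding cone_def by blast
qed

lemma cone_closed: "closed cone"
  unfolding closed_sequential_limits
proof (intro allI impI, elim conjE)
  fix w and l :: "real \<Rightarrow>\<^sub>C real" assume "\<forall>n::nat. w n \<in> cone" and lim: "w \<longlonglongrightarrow> l"
  then have w: "w n \<in> cone" for n by blast
  have pt: "(\<lambda>n. w n x) \<longlonglongrightarrow> l x" for x
    using tendsto_bcontfun_uniform_limit[OF lim] by (rule tendsto_uniform_limitI) simp
  have "l x = l (clamp01 x)" for x
  proof (rule LIMSEQ_unique[OF pt])
    show "(\<lambda>n. w n x) \<longlonglongrightarrow> l (clamp01 x)"
      using pt[of "clamp01 x"] by (subst coneD(1)[OF w])
  qed
  moreover have "c * \<bar>l s\<bar> \<le> l t" if "t \<in> {a..b}" "s \<in> {0..1}" for s t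
  proof (rule LIMSEQ_le[OF _ pt])
    show "(\<lambda>n. c * \<bar>w n s\<bar>) \<longlonglongrightarrow> c * \<bar>l s\<bar>" by (intro tendsto_intros pt)
    show "\<exists>N. \<forall>n\<ge>N. c * \<bar>w n s\<bar> \<le> w n t" using coneD(2)[OF w that] by blast
  qed
  ultimately show "l \<in> cone" unfolding cone_def by blast
qed

lemma cone_const: "0 \<le> m \<Longrightarrow> const_bcontfun m \<in> cone"
proof -
  assume "0 \<le> m"
  then have "c * m \<le> 1 * m" using c by (intro mult_right_mono) auto
  with \<open>0 \<le> m\<close> show ?thesis by (simp add: cone_def const_bcontfun.rep_eq)
qed

lemma supnorm01_restrict:
  assumes w: "w \<in> cone"
  shows "supnorm01 (restrict (apply_bcontfun w) {0..1}) = norm w"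
proof (rule antisym)
  have eq: "supnorm01 (restrict (apply_bcontfun w) {0..1}) = (SUP t\<in>{0..1}. \<bar>apply_bcontfun w t\<bar>)"
    unfolding supnorm01_def by (intro SUP_cong refl) simp
  show "supnorm01 (restrict (apply_bcontfun w) {0..1}) \<le> norm w"
    unfolding eq by (intro cSUP_least abs_bcontfun_le_norm) simp
  show "norm w \<le> supnorm01 (restrict (apply_bcontfun w) {0..1})"
    unfolding eq
  proof (rule norm_bcontfun_leI)
    fix x
    have "\<bar>apply_bcontfun w (clamp01 x)\<bar> \<le> (SUP t\<in>{0..1}. \<bar>apply_bcontfun w t\<bar>)"
      by (rule cSUP_upper[OF clamp01_in bdd_aboveI2]) (rule abs_bcontfun_le_norm)
    then show "\<bar>apply_bcontfun w x\<bar> \<le> (SUP t\<in>{0..1}. \<bar>apply_bcontfun w t\<bar>)"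
      by (simp only: coneD(1)[OF w, of x])
  qed
qed

lemma restrict_in_K_tilde:
  assumes w: "w \<in> cone"
  shows "restrict (apply_bcontfun w) {0..1} \<in> K_tilde a b c"
proof -
  have "(INF t\<in>{a..b}. restrict (apply_bcontfun w) {0..1} t) = interval_min w"
    unfolding interval_min_def using ab by (intro INF_cong refl) simp
  moreover have "continuous_on {0..1} (restrict (apply_bcontfun w) {0..1})"
    by (rule continuous_on_eq[OF continuous_on_apply_bcontfun[of "{0..1}" w]]) simp
  ultimately show ?thesis
    using norm_le_interval_min[OF w] by (simp add: K_tilde_def C01_def supnorm01_restrict[OF w])
qed

lemma restrict_inj_on_cone: "inj_on (\<lambda>w. restrict (apply_bcontfun w) {0..1}) cone"
proof (rule inj_onI)
  fix u v assume u: "u \<in> cone" and v: "v \<in> cone"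
    and eq: "restrict (apply_bcontfun u) {0..1} = restrict (apply_bcontfun v) {0..1}"
  show "u = v"
  proof (rule bcontfun_eqI)
    fix x
    have "restrict (apply_bcontfun u) {0..1} (clamp01 x) = restrict (apply_bcontfun v) {0..1} (clamp01 x)"
      by (simp only: eq)
    then have "apply_bcontfun u (clamp01 x) = apply_bcontfun v (clamp01 x)"
      by (simp only: restrict_apply' clamp01_in)
    then show "apply_bcontfun u x = apply_bcontfun v x"
      by (subst coneD(1)[OF u], subst coneD(1)[OF v])
  qed
qed

end

context hammerstein_operator
begin

sublocale interval_cone a b c
  by unfold_locales (use ab c in auto)

definition kernel_bcont :: "(real \<Rightarrow> real) \<Rightarrow> (real \<Rightarrow>\<^sub>C real)" where
  "kernel_bcont h = Bcontfun (\<lambda>x. kernel_op h (clamp01 x))"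

lemma kernel_bcont_apply:
  assumes h: "admissible B h"
  shows "kernel_bcont h x = kernel_op h (clamp01 x)"
proof -
  have "(\<lambda>x. kernel_op h (clamp01 x)) \<in> bcontfun"
  proof (rule bcontfun_normI)
    show "continuous_on UNIV (\<lambda>x. kernel_op h (clamp01 x))"
      by (rule continuous_on_compose2[OF kernel_op_continuous[OF h] clamp01_continuous]) (use clamp01_in in auto)
    show "norm (kernel_op h (clamp01 x)) \<le> B * (LINT s|leb01. g s * \<Phi> s)" for x
      using kernel_op_bounded[OF clamp01_in h] by simp
  qed
  then show ?thesis by (simp add: kernel_bcont_def Bcontfun_inverse)
qed

lemma kernel_bcont_cone: assumes h: "admissible B h" shows "kernel_bcont h \<in> cone"
proof -
  have "c * \<bar>kernel_bcont h s\<bar> \<le> kernel_bcont h t" if "t \<in> {a..b}" "s \<in> {0..1}" for s t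
  proof -
    have "t \<in> {0..1}" using that ab_subset by auto
    with kernel_op_cone[OF that h] that(2) show ?thesis by (simp add: kernel_bcont_apply[OF h] clamp01_id)
  qed
  moreover have "kernel_bcont h x = kernel_bcont h (clamp01 x)" for x
    by (simp add: kernel_bcont_apply[OF h] clamp01_id[OF clamp01_in])
  ultimately show ?thesis unfolding cone_def by blast
qed

lemma kernel_bcont_tendsto:
  assumes H: "\<And>n. admissible B (H n)" and h: "admissible B h"
    and lim: "AE s in leb01. (\<lambda>n. H n s) \<longlonglongrightarrow> h s"
  shows "(\<lambda>n. kernel_bcont (H n)) \<longlonglongrightarrow> kernel_bcont h"
proof (rule uniform_limit_tendsto_bcontfun, rule uniform_limitI)
  fix e :: real assume "0 < e"
  from uniform_limitD[OF kernel_op_uniform_limit[OF H h lim] this]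
  show "\<forall>\<^sub>F n in sequentially. \<forall>x\<in>UNIV. dist (kernel_bcont (H n) x) (kernel_bcont h x) < e"
    by eventually_elim (simp add: kernel_bcont_apply[OF H] kernel_bcont_apply[OF h] clamp01_in del: atLeastAtMost_iff)
qed

text \<open>
  By Arzela and Ascoli: the images are uniformly bounded and equicontinuous on \<open>[0,1]\<close>. The limit
  extends to the line by the retraction.
\<close>

lemma kernel_bcont_relatively_compact: "compact (closure (kernel_bcont ` Collect (admissible B)))"
proof (rule compact_closureI_subseq)
  fix x :: "nat \<Rightarrow> real \<Rightarrow>\<^sub>C real" assume "\<And>n. x n \<in> kernel_bcont ` Collect (admissible B)"
  then have "\<exists>h. admissible B h \<and> x n = kernel_bcont h" for n by blast
  then obtain H where H: "\<And>n. admissible B (H n)" and x: "\<And>n. x n = kernel_bcont (H n)" by metis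
  obtain w r where w: "continuous_on {0..1} w" and r: "strict_mono (r :: nat \<Rightarrow> nat)"
    and lim: "\<And>e. 0 < e \<Longrightarrow> \<exists>N. \<forall>n x. n \<ge> N \<and> x \<in> {0..1} \<longrightarrow> norm (kernel_op (H (r n)) x - w x) < e"
  proof (rule Arzela_Ascoli[of "{0..1}" "\<lambda>n. kernel_op (H n)" "B * (LINT s|leb01. g s * \<Phi> s)"])
    show "norm (kernel_op (H n) t) \<le> B * (LINT s|leb01. g s * \<Phi> s)" if "t \<in> {0..1}" for n t
      using kernel_op_bounded[OF that H] by simp
    show "\<exists>d>0. \<forall>n y. y \<in> {0..1} \<and> norm (t - y) < d \<longrightarrow> norm (kernel_op (H n) t - kernel_op (H n) y) < e"
      if te: "t \<in> {0..1}" "0 < e" for t e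
    proof -
      obtain d where d: "0 < d"
        and close: "\<And>y h. y \<in> {0..1} \<Longrightarrow> \<bar>y - t\<bar> < d \<Longrightarrow> admissible B h \<Longrightarrow> \<bar>kernel_op h y - kernel_op h t\<bar> < e"
        using kernel_op_equicontinuous[OF te, of B] by blast
      show ?thesis
      proof (intro exI[of _ d] conjI allI impI d)
        fix n y assume "y \<in> {0..1} \<and> norm (t - y) < d"
        then show "norm (kernel_op (H n) t - kernel_op (H n) y) < e"
          using close[of y "H n"] H by (simp add: abs_minus_commute)
      qed
    qed
  qed auto
  have "uniform_limit UNIV (\<lambda>n. apply_bcontfun (x (r n))) (\<lambda>x. w (clamp01 x)) sequentially"
  proof (rule uniform_limitI)
    fix e :: real assume "0 < e"
    from lim[OF this] obtain N where N: "\<And>n t. n \<ge> N \<Longrightarrow> t \<in> {0..1} \<Longrightarrow> norm (kernel_op (H (r n)) t - w t) < e" by blast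
    have "dist (x (r n) t) (w (clamp01 t)) < e" if "n \<ge> N" for n t
      using N[OF that clamp01_in, of t] by (simp add: x kernel_bcont_apply[OF H] dist_real_def)
    then show "\<forall>\<^sub>F n in sequentially. \<forall>t\<in>UNIV. dist (x (r n) t) (w (clamp01 t)) < e"
      by (auto simp: eventually_sequentially)
  qed
  then obtain l where "(\<lambda>n. x (r n)) \<longlonglongrightarrow> l" using uniform_limit_bcontfunE by (metis sequentially_bot)
  with r show "\<exists>l r. strict_mono (r :: nat \<Rightarrow> nat) \<and> (\<lambda>n. x (r n)) \<longlonglongrightarrow> l" by blast
qed

definition superpose :: "(real \<Rightarrow>\<^sub>C real) \<Rightarrow> (real \<Rightarrow>\<^sub>C real) \<Rightarrow> real \<Rightarrow> real" where
  "superpose u v s = f s (u s) (v s)"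

lemma superpose_admissible:
  assumes R: "0 < R"
  obtains B where "\<And>u v. norm u \<le> R \<Longrightarrow> norm v \<le> R \<Longrightarrow> admissible B (superpose u v)"
proof -
  obtain B where B: "AE s in leb01. \<forall>u v. \<bar>u\<bar> \<le> R \<longrightarrow> \<bar>v\<bar> \<le> R \<longrightarrow> f s u v \<le> B"
    using caratheodory_bounded[OF f_car R] by blast
  have "admissible B (superpose u v)" if uv: "norm u \<le> R" "norm v \<le> R" for u v
  proof -
    have meas: "apply_bcontfun w \<in> borel_measurable leb01" for w :: "real \<Rightarrow>\<^sub>C real"
      by (intro continuous_imp_measurable_on_sets_lebesgue continuous_on_apply_bcontfun) simp
    have "superpose u v \<in> borel_measurable leb01"
      unfolding superpose_def[abs_def] by (rule superposition_measurable[OF f_car meas meas])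
    moreover have "AE s in leb01. 0 \<le> superpose u v s \<and> superpose u v s \<le> B"
      using B AE_space
    proof eventually_elim
      case (elim s)
      have "\<bar>u s\<bar> \<le> R" "\<bar>v s\<bar> \<le> R"
        using abs_bcontfun_le_norm[of u s] abs_bcontfun_le_norm[of v s] uv by linarith+
      then show ?case using elim f_nonneg[of s] by (simp add: superpose_def)
    qed
    ultimately show ?thesis unfolding admissible_def by blast
  qed
  then show ?thesis by (rule that)
qed

lemma kernel_op_restrict:
  "kernel_op (superpose u v) t =
    (LINT s|leb01. k t s * g s * f s (restrict (apply_bcontfun u) {0..1} s) (restrict (apply_bcontfun v) {0..1} s))"
  unfolding kernel_op_def superpose_def by (rule Bochner_Integration.integral_cong) auto

lemma superpose_admissible_ex: obtains B where "admissible B (superpose u v)"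
proof -
  have "0 < max (norm u) (norm v) + 1" by (simp add: add_nonneg_pos le_max_iff_disj)
  from superpose_admissible[OF this] obtain B where
    B: "\<And>u' v'. norm u' \<le> max (norm u) (norm v) + 1 \<Longrightarrow> norm v' \<le> max (norm u) (norm v) + 1 \<Longrightarrow> admissible B (superpose u' v')"
    by blast
  have "admissible B (superpose u v)" by (rule B) auto
  then show ?thesis by (rule that)
qed

lemma superpose_tendsto:
  assumes "(U :: nat \<Rightarrow> _) \<longlonglongrightarrow> u" "V \<longlonglongrightarrow> v"
  shows "AE s in leb01. (\<lambda>n. superpose (U n) (V n) s) \<longlonglongrightarrow> superpose u v s"
proof -
  have pt: "(\<lambda>n. W n x) \<longlonglongrightarrow> w x" if "W \<longlonglongrightarrow> w" for W :: "nat \<Rightarrow> real \<Rightarrow>\<^sub>C real" and w x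
    using tendsto_bcontfun_uniform_limit[OF that] by (rule tendsto_uniform_limitI) simp
  have "AE t in leb01. continuous_on UNIV (\<lambda>(u, v). f t u v)" using f_car by (simp add: caratheodory_def)
  then show ?thesis
    unfolding superpose_def
    by eventually_elim (rule continuous_pair_LIMSEQ[OF _ pt[OF assms(1)] pt[OF assms(2)]])
qed

text \<open>
  The mechanism behind \<open>I\<^sup>0\<close>: a source term above \<open>M * \<rho>\<close> on \<open>[a, b]\<close> lifts the image above
  \<open>\<rho>\<close> there, and a nonnegative constant lifts it further.
\<close>

lemma interval_min_greater:
  assumes \<rho>: "0 < \<rho>" and \<mu>: "M_const k g a b < \<mu>"
    and ge: "\<And>s. s \<in> {a..b} \<Longrightarrow> \<mu> * \<rho> \<le> f s (apply_bcontfun u s) (apply_bcontfun v s)"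
    and l: "0 \<le> l" and eq: "w = kernel_bcont (superpose u v) + l *\<^sub>R const_bcontfun 1"
  shows "\<rho> < interval_min w"
proof -
  obtain B where B: "admissible B (superpose u v)" by (rule superpose_admissible_ex)
  obtain r' where r': "\<rho> < r'" "\<And>t. t \<in> {a..b} \<Longrightarrow> r' \<le> kernel_op (superpose u v) t"
    using kernel_op_greater[OF \<rho> \<mu> B] ge unfolding superpose_def by blast
  have "r' \<le> interval_min w"
  proof (rule interval_min_ge)
    fix t assume t: "t \<in> {a..b}"
    then have "t \<in> {0..1}" using ab_subset by auto
    with r'(2)[OF t] l show "r' \<le> w t"
      by (simp add: eq kernel_bcont_apply[OF B] clamp01_id const_bcontfun.rep_eq)
  qed
  with r'(1) show ?thesis by simp
qed

lemma norm_kernel_bcont_less: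
  assumes r: "0 < r" and \<mu>: "\<mu> < m_const k g"
    and le: "\<And>s. s \<in> {0..1} \<Longrightarrow> f s (apply_bcontfun u s) (apply_bcontfun v s) \<le> \<mu> * r"
  shows "norm (kernel_bcont (superpose u v)) < r"
proof -
  obtain B where B: "admissible B (superpose u v)" by (rule superpose_admissible_ex)
  obtain r' where r': "r' < r" "\<And>t. t \<in> {0..1} \<Longrightarrow> \<bar>kernel_op (superpose u v) t\<bar> \<le> r'"
    using kernel_op_less[OF r \<mu> B] le unfolding superpose_def by blast
  have "norm (kernel_bcont (superpose u v)) \<le> r'"
    by (rule norm_bcontfun_leI) (unfold kernel_bcont_apply[OF B], rule r'(2)[OF clamp01_in])
  with r'(1) show ?thesis by simp
qed

end

section \<open>The system of two equations\<close>

lemma inf_on_box_greater: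
  assumes "ereal M < inf_on_box f \<rho> A U V" and \<rho>: "0 < \<rho>"
  obtains \<mu> where "M < \<mu>" "\<And>t u v. t \<in> A \<Longrightarrow> u \<in> U \<Longrightarrow> v \<in> V \<Longrightarrow> \<mu> * \<rho> \<le> f t u v"
proof -
  obtain \<mu> where \<mu>: "ereal M < ereal \<mu>" "ereal \<mu> < inf_on_box f \<rho> A U V"
    using ereal_dense2[OF assms(1)] by blast
  have "\<mu> * \<rho> \<le> f t u v" if "t \<in> A" "u \<in> U" "v \<in> V" for t u v
  proof -
    have "inf_on_box f \<rho> A U V \<le> ereal (f t u v / \<rho>)"
      unfolding inf_on_box_def using that by (intro INF_lower2[of "(t, u, v)"]) auto
    with \<mu>(2) have "ereal \<mu> < ereal (f t u v / \<rho>)" by (rule less_le_trans)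
    then show ?thesis using \<rho> by (simp add: pos_less_divide_eq less_imp_le)
  qed
  with \<mu>(1) show ?thesis by (intro that[of \<mu>]) auto
qed

lemma sup_on_box_less:
  assumes "sup_on_box f r A U V < ereal m" and r: "0 < r"
  obtains \<mu> where "\<mu> < m" "\<And>t u v. t \<in> A \<Longrightarrow> u \<in> U \<Longrightarrow> v \<in> V \<Longrightarrow> f t u v \<le> \<mu> * r"
proof -
  obtain \<mu> where \<mu>: "sup_on_box f r A U V < ereal \<mu>" "ereal \<mu> < ereal m"
    using ereal_dense2[OF assms(1)] by blast
  have "f t u v \<le> \<mu> * r" if "t \<in> A" "u \<in> U" "v \<in> V" for t u v
  proof -
    have "ereal (f t u v / r) \<le> sup_on_box f r A U V"
      unfolding sup_on_box_def using that by (intro SUP_upper2[of "(t, u, v)"]) auto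
    then have "ereal (f t u v / r) < ereal \<mu>" using \<mu>(1) by (rule le_less_trans)
    then show ?thesis using r by (simp add: pos_divide_less_eq less_imp_le)
  qed
  with \<mu>(2) show ?thesis by (intro that[of \<mu>]) auto
qed

locale hammerstein_system =
  fixes f :: "nat \<Rightarrow> real \<Rightarrow> real \<Rightarrow> real \<Rightarrow> real"
    and k :: "nat \<Rightarrow> real \<Rightarrow> real \<Rightarrow> real"
    and g \<Phi> :: "nat \<Rightarrow> real \<Rightarrow> real"
    and a b c :: "nat \<Rightarrow> real"
  assumes standing: "\<forall>i\<in>{1, 2}. standing_assumptions (f i) (k i) (g i) (\<Phi> i) (a i) (b i) (c i)"
begin

sublocale H1: hammerstein_operator "f 1" "k 1" "g 1" "\<Phi> 1" "a 1" "b 1" "c 1"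
  by unfold_locales (use standing in auto)

sublocale H2: hammerstein_operator "f 2" "k 2" "g 2" "\<Phi> 2" "a 2" "b 2" "c 2"
  by unfold_locales (use standing in auto)

definition K :: "((real \<Rightarrow>\<^sub>C real) \<times> (real \<Rightarrow>\<^sub>C real)) set" where
  "K = H1.cone \<times> H2.cone"

definition norm_gauge :: "(nat \<Rightarrow> real) \<Rightarrow> (real \<Rightarrow>\<^sub>C real) \<times> (real \<Rightarrow>\<^sub>C real) \<Rightarrow> real" where
  "norm_gauge r w = max (norm (fst w) / r 1) (norm (snd w) / r 2)"

definition min_gauge :: "(nat \<Rightarrow> real) \<Rightarrow> (real \<Rightarrow>\<^sub>C real) \<times> (real \<Rightarrow>\<^sub>C real) \<Rightarrow> real" where
  "min_gauge r w = max (H1.interval_min (fst w) / r 1) (H2.interval_min (snd w) / r 2)"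

definition T :: "(real \<Rightarrow>\<^sub>C real) \<times> (real \<Rightarrow>\<^sub>C real) \<Rightarrow> (real \<Rightarrow>\<^sub>C real) \<times> (real \<Rightarrow>\<^sub>C real)" where
  "T w = (H1.kernel_bcont (H1.superpose (fst w) (snd w)), H2.kernel_bcont (H2.superpose (fst w) (snd w)))"

definition unit_pair :: "(real \<Rightarrow>\<^sub>C real) \<times> (real \<Rightarrow>\<^sub>C real)" where
  "unit_pair = (const_bcontfun 1, const_bcontfun 1)"

text \<open>
  In terms of the fixed point index, this boundary condition gives index \<open>0\<close> on
  \<open>min_gauge \<rho> < 1\<close>, and \<open>no_stretch_on r\<close> gives index \<open>1\<close> on \<open>norm_gauge r < 1\<close>.
\<close>

definition no_lift_on :: "(nat \<Rightarrow> real) \<Rightarrow> bool" where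
  "no_lift_on \<rho> \<longleftrightarrow> (\<forall>w\<in>K. \<forall>l\<ge>0. min_gauge \<rho> w = 1 \<longrightarrow> w \<noteq> T w + l *\<^sub>R unit_pair)"

definition no_stretch_on :: "(nat \<Rightarrow> real) \<Rightarrow> bool" where
  "no_stretch_on r \<longleftrightarrow> (\<forall>w\<in>K. \<forall>l\<ge>1. norm_gauge r w = 1 \<longrightarrow> T w \<noteq> l *\<^sub>R w)"

lemma K_add: "x \<in> K \<Longrightarrow> y \<in> K \<Longrightarrow> x + y \<in> K"
  using H1.cone_add H2.cone_add by (auto simp: K_def)

lemma K_scale: "0 \<le> l \<Longrightarrow> x \<in> K \<Longrightarrow> l *\<^sub>R x \<in> K"
  using H1.cone_scale H2.cone_scale by (auto simp: K_def)

lemma unit_pair: "unit_pair \<in> K" "unit_pair \<noteq> 0"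
proof -
  show "unit_pair \<in> K" using H1.cone_const[of 1] H2.cone_const[of 1] by (simp add: unit_pair_def K_def)
  show "unit_pair \<noteq> 0"
  proof
    assume "unit_pair = 0"
    then have "const_bcontfun 1 = (0 :: real \<Rightarrow>\<^sub>C real)" by (simp add: unit_pair_def prod_eq_iff)
    then have "const_bcontfun 1 (0::real) = apply_bcontfun (0 :: real \<Rightarrow>\<^sub>C real) 0" by (rule arg_cong[where f = "\<lambda>w. apply_bcontfun w 0"])
    then show False by (simp add: const_bcontfun.rep_eq)
  qed
qed

lemma norm_gauge_continuous: "0 < r 1 \<Longrightarrow> 0 < r 2 \<Longrightarrow> continuous_on A (norm_gauge r)"
  unfolding norm_gauge_def[abs_def] by (intro continuous_intros) auto

lemma min_gauge_continuous: "0 < r 1 \<Longrightarrow> 0 < r 2 \<Longrightarrow> continuous_on A (min_gauge r)"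
  unfolding min_gauge_def[abs_def]
  by (intro continuous_intros continuous_on_compose2[OF H1.interval_min_continuous[of UNIV]]
      continuous_on_compose2[OF H2.interval_min_continuous[of UNIV]]) auto

lemma norm_gauge_scale: "0 \<le> l \<Longrightarrow> norm_gauge r (l *\<^sub>R w) = l * norm_gauge r w"
  by (simp add: norm_gauge_def max_mult_distrib_left)

lemma min_gauge_scale: "0 \<le> l \<Longrightarrow> min_gauge r (l *\<^sub>R w) = l * min_gauge r w"
  by (simp add: min_gauge_def max_mult_distrib_left H1.interval_min_scale H2.interval_min_scale del: One_nat_def)

lemma K_bounds:
  assumes "w \<in> K"
  shows "c 1 * norm (fst w) \<le> H1.interval_min (fst w)" "c 2 * norm (snd w) \<le> H2.interval_min (snd w)"
    and "0 \<le> H1.interval_min (fst w)" "0 \<le> H2.interval_min (snd w)"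
  using assms H1.norm_le_interval_min H2.norm_le_interval_min H1.interval_min_nonneg H2.interval_min_nonneg by (auto simp: K_def)

lemma min_gauge_le_norm_gauge:
  assumes "w \<in> K" and "\<And>i. i \<in> {1, 2} \<Longrightarrow> 0 < \<rho> i \<and> \<rho> i \<le> r i"
  shows "min_gauge r w \<le> norm_gauge \<rho> w"
proof -
  have "H1.interval_min (fst w) / r 1 \<le> norm (fst w) / \<rho> 1"
    by (rule frac_le[OF norm_ge_zero H1.interval_min_le_norm]) (use assms(2)[of 1] in simp_all)
  moreover have "H2.interval_min (snd w) / r 2 \<le> norm (snd w) / \<rho> 2"
    by (rule frac_le[OF norm_ge_zero H2.interval_min_le_norm]) (use assms(2)[of 2] in simp_all)
  ultimately show ?thesis unfolding min_gauge_def norm_gauge_def by linarith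
qed

text \<open>
  This is where the factors \<open>c i\<close> in the hypotheses on the radii come from: in the
  cone the minimum controls the norm only up to \<open>c i\<close>.
\<close>

lemma norm_gauge_le_min_gauge:
  assumes w: "w \<in> K" and "\<And>i. i \<in> {1, 2} \<Longrightarrow> 0 < \<rho> i \<and> \<rho> i / c i \<le> r i"
  shows "norm_gauge r w \<le> min_gauge \<rho> w"
proof -
  have *: "x / r' \<le> y / \<rho>'" if "0 \<le> x" "c' * x \<le> y" "0 < \<rho>'" "\<rho>' / c' \<le> r'" "0 < c'" for x y r' \<rho>' c' :: real
  proof -
    have "x / r' \<le> x / (\<rho>' / c')" using that by (intro divide_left_mono mult_pos_pos) (auto intro: less_le_trans[of 0 "\<rho>' / c'"])
    also have "\<dots> = c' * x / \<rho>'" using that by simp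
    also have "\<dots> \<le> y / \<rho>'" using that by (intro divide_right_mono) auto
    finally show ?thesis .
  qed
  have "norm (fst w) / r 1 \<le> H1.interval_min (fst w) / \<rho> 1"
    by (rule *[OF _ K_bounds(1)[OF w]]) (use assms(2)[of 1] H1.c in auto)
  moreover have "norm (snd w) / r 2 \<le> H2.interval_min (snd w) / \<rho> 2"
    by (rule *[OF _ K_bounds(2)[OF w]]) (use assms(2)[of 2] H2.c in auto)
  ultimately show ?thesis unfolding min_gauge_def norm_gauge_def by linarith
qed

lemma norm_gauge_pos:
  assumes "w \<noteq> 0" "0 < r 1" "0 < r 2" shows "0 < norm_gauge r w"
proof -
  have "fst w \<noteq> 0 \<or> snd w \<noteq> 0" using assms(1) by (simp add: prod_eq_iff)
  then show ?thesis using assms(2,3) by (auto simp: norm_gauge_def less_max_iff_disj)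
qed

lemma min_gauge_pos:
  assumes w: "w \<in> K" "w \<noteq> 0" and r: "0 < r 1" "0 < r 2" shows "0 < min_gauge r w"
proof -
  have "0 < norm_gauge (\<lambda>i. r i / c i) w"
    using H1.c H2.c r by (intro norm_gauge_pos[OF w(2)]) auto
  also have "\<dots> \<le> min_gauge r w"
    by (rule norm_gauge_le_min_gauge[OF w(1)]) (use r in auto)
  finally show ?thesis .
qed

text \<open>
  Complete continuity: on bounded sets the source terms are bounded by a common constant, so the
  images lie in one compact set, which is contained in \<open>K\<close> because the cone is closed.
\<close>

lemma T_compact:
  assumes R: "0 < R"
  defines "A \<equiv> {w \<in> K. norm (fst w) \<le> R \<and> norm (snd w) \<le> R}"
  obtains C where "continuous_on A T" "T ` A \<subseteq> C" "compact C" "C \<subseteq> K"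
proof -
  obtain B1 where B1: "\<And>u v. norm u \<le> R \<Longrightarrow> norm v \<le> R \<Longrightarrow> H1.admissible B1 (H1.superpose u v)"
    by (rule H1.superpose_admissible[OF R]) blast
  obtain B2 where B2: "\<And>u v. norm u \<le> R \<Longrightarrow> norm v \<le> R \<Longrightarrow> H2.admissible B2 (H2.superpose u v)"
    by (rule H2.superpose_admissible[OF R]) blast
  define C where "C = closure (H1.kernel_bcont ` Collect (H1.admissible B1)) \<times> closure (H2.kernel_bcont ` Collect (H2.admissible B2))"
  show ?thesis
  proof (rule that)
    show "compact C" unfolding C_def
      by (intro compact_Times H1.kernel_bcont_relatively_compact H2.kernel_bcont_relatively_compact)
    show "C \<subseteq> K" unfolding C_def K_def
      using H1.kernel_bcont_cone H2.kernel_bcont_cone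
      by (intro Sigma_mono closure_minimal H1.cone_closed H2.cone_closed) auto
    show "T ` A \<subseteq> C"
    proof (rule image_subsetI)
      fix w assume "w \<in> A"
      then have n: "norm (fst w) \<le> R" "norm (snd w) \<le> R" by (simp_all add: A_def)
      show "T w \<in> C" unfolding C_def T_def
        using B1[OF n] B2[OF n] by (auto intro!: subsetD[OF closure_subset])
    qed
    show "continuous_on A T"
    proof (rule continuous_on_sequentiallyI)
      fix W w assume W: "\<forall>n. W n \<in> A" and w: "w \<in> A" and lim: "W \<longlonglongrightarrow> w"
      have lim1: "(\<lambda>n. fst (W n)) \<longlonglongrightarrow> fst w" by (rule tendsto_fst[OF lim])
      have lim2: "(\<lambda>n. snd (W n)) \<longlonglongrightarrow> snd w" by (rule tendsto_snd[OF lim])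
      have nW: "norm (fst (W n)) \<le> R" "norm (snd (W n)) \<le> R" for n using W by (simp_all add: A_def)
      have nw: "norm (fst w) \<le> R" "norm (snd w) \<le> R" using w by (simp_all add: A_def)
      show "(\<lambda>n. T (W n)) \<longlonglongrightarrow> T w" unfolding T_def
        by (intro tendsto_Pair H1.kernel_bcont_tendsto[OF B1[OF nW] B1[OF nw] H1.superpose_tendsto[OF lim1 lim2]]
            H2.kernel_bcont_tendsto[OF B2[OF nW] B2[OF nw] H2.superpose_tendsto[OF lim1 lim2]])
    qed
  qed
qed

lemma compression_solution:
  assumes r: "\<And>i. i \<in> {1, 2} \<Longrightarrow> 0 < \<rho> i \<and> 0 < r i \<and> \<rho> i / c i \<le> r i"
    and inner: "no_lift_on \<rho>" and outer: "no_stretch_on r"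
  shows "\<exists>w\<in>K. 1 < min_gauge \<rho> w \<and> norm_gauge r w < 1 \<and> T w = w"
proof -
  have pos: "0 < \<rho> 1" "0 < \<rho> 2" "0 < r 1" "0 < r 2" using r[of 1] r[of 2] by auto
  interpret cone_annulus K "norm_gauge r" "min_gauge \<rho>"
  proof
    show "norm_gauge r x \<le> min_gauge \<rho> x" if "x \<in> K" for x
      by (rule norm_gauge_le_min_gauge[OF that]) (use r in auto)
  qed (use pos in \<open>auto intro: K_add K_scale norm_gauge_continuous min_gauge_continuous norm_gauge_pos
      simp: norm_gauge_scale min_gauge_scale\<close>)
  have R: "0 < max (r 1) (r 2)" using pos by simp
  obtain C where C: "continuous_on {w \<in> K. norm (fst w) \<le> max (r 1) (r 2) \<and> norm (snd w) \<le> max (r 1) (r 2)} T"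
      "T ` {w \<in> K. norm (fst w) \<le> max (r 1) (r 2) \<and> norm (snd w) \<le> max (r 1) (r 2)} \<subseteq> C" "compact C" "C \<subseteq> K"
    by (rule T_compact[OF R])
  have sub: "annulus \<subseteq> {w \<in> K. norm (fst w) \<le> max (r 1) (r 2) \<and> norm (snd w) \<le> max (r 1) (r 2)}"
    using pos by (auto simp: annulus_def norm_gauge_def pos_divide_le_eq le_max_iff_disj)
  show ?thesis
  proof (rule compression[OF continuous_on_subset[OF C(1) sub] _ C(3,4) unit_pair])
    show "T ` annulus \<subseteq> C" using C(2) sub by blast
    show "x \<noteq> T x + l *\<^sub>R unit_pair" if "x \<in> annulus" "min_gauge \<rho> x = 1" "0 \<le> l" for x l
      using inner that unfolding no_lift_on_def annulus_def by blast
    show "T x \<noteq> l *\<^sub>R x" if "x \<in> annulus" "norm_gauge r x = 1" "1 \<le> l" for x l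
      using outer that unfolding no_stretch_on_def annulus_def by blast
  qed
qed

lemma expansion_solution:
  assumes r: "\<And>i. i \<in> {1, 2} \<Longrightarrow> 0 < \<rho> i \<and> 0 < r i \<and> \<rho> i \<le> r i"
    and inner: "no_stretch_on \<rho>" and outer: "no_lift_on r"
  shows "\<exists>w\<in>K. 1 < norm_gauge \<rho> w \<and> min_gauge r w < 1 \<and> T w = w"
proof -
  have pos: "0 < \<rho> 1" "0 < \<rho> 2" "0 < r 1" "0 < r 2" using r[of 1] r[of 2] by auto
  interpret cone_annulus K "min_gauge r" "norm_gauge \<rho>"
  proof
    show "min_gauge r x \<le> norm_gauge \<rho> x" if "x \<in> K" for x
      by (rule min_gauge_le_norm_gauge[OF that]) (use r in auto)
  qed (use pos in \<open>auto intro: K_add K_scale norm_gauge_continuous min_gauge_continuous min_gauge_pos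
      simp: norm_gauge_scale min_gauge_scale\<close>)
  define R where "R = max (r 1 / c 1) (r 2 / c 2)"
  have R: "0 < R" using pos H1.c by (simp add: R_def less_max_iff_disj)
  obtain C where C: "continuous_on {w \<in> K. norm (fst w) \<le> R \<and> norm (snd w) \<le> R} T"
      "T ` {w \<in> K. norm (fst w) \<le> R \<and> norm (snd w) \<le> R} \<subseteq> C" "compact C" "C \<subseteq> K"
    by (rule T_compact[OF R])
  have top_le: "norm_gauge (\<lambda>i. r i / c i) x \<le> min_gauge r x" if "x \<in> K" for x
    by (rule norm_gauge_le_min_gauge[OF that]) (use pos in auto)
  have sub: "annulus \<subseteq> {w \<in> K. norm (fst w) \<le> R \<and> norm (snd w) \<le> R}"
  proof
    fix x assume "x \<in> annulus"
    then have x: "x \<in> K" and "norm_gauge (\<lambda>i. r i / c i) x \<le> 1"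
      using top_le[of x] by (auto simp: annulus_def)
    then have "norm (fst x) / (r 1 / c 1) \<le> 1" "norm (snd x) / (r 2 / c 2) \<le> 1"
      by (auto simp: norm_gauge_def)
    moreover have "0 < r 1 / c 1" "0 < r 2 / c 2" using pos H1.c H2.c by auto
    ultimately have "norm (fst x) \<le> r 1 / c 1" "norm (snd x) \<le> r 2 / c 2"
      by (simp_all only: pos_divide_le_eq mult_1)
    then show "x \<in> {w \<in> K. norm (fst w) \<le> R \<and> norm (snd w) \<le> R}"
      using x by (simp add: R_def le_max_iff_disj)
  qed
  define B where "B = max (r 1 / c 1 / \<rho> 1) (r 2 / c 2 / \<rho> 2)"
  show ?thesis
  proof (rule expansion[OF continuous_on_subset[OF C(1) sub] _ C(3,4) unit_pair])
    show "T ` annulus \<subseteq> C" using C(2) sub by blast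
    show "T x \<noteq> l *\<^sub>R x" if "x \<in> annulus" "norm_gauge \<rho> x = 1" "1 \<le> l" for x l
      using inner that unfolding no_stretch_on_def annulus_def by blast
    show "x \<noteq> T x + l *\<^sub>R unit_pair" if "x \<in> annulus" "min_gauge r x = 1" "0 \<le> l" for x l
      using outer that unfolding no_lift_on_def annulus_def by blast
    show "norm_gauge \<rho> x \<le> B * min_gauge r x" if x: "x \<in> K" for x
    proof -
      have B0: "0 < B" using pos H1.c by (simp add: B_def less_max_iff_disj)
      have "n / d \<le> B * min_gauge r x"
        if n: "n / q \<le> min_gauge r x" "0 \<le> n" and q: "0 < q" "0 < d" "q / d \<le> B" for n q d
      proof -
        have "n / d = (q / d) * (n / q)" using q by simp
        also have "\<dots> \<le> B * min_gauge r x"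
          using n q B0 by (intro mult_mono) (auto intro: divide_nonneg_pos)
        finally show ?thesis .
      qed
      moreover have "norm (fst x) / (r 1 / c 1) \<le> min_gauge r x" "norm (snd x) / (r 2 / c 2) \<le> min_gauge r x"
        using top_le[OF x] by (auto simp: norm_gauge_def)
      moreover have "0 < r 1 / c 1" "0 < r 2 / c 2" "r 1 / c 1 / \<rho> 1 \<le> B" "r 2 / c 2 / \<rho> 2 \<le> B"
        using pos H1.c H2.c by (auto simp: B_def)
      ultimately show ?thesis
        using pos norm_ge_zero[of "fst x"] norm_ge_zero[of "snd x"] unfolding norm_gauge_def by (intro max.boundedI) blast+
    qed
  qed
qed

lemma cond_I1_no_stretch:
  assumes I1: "cond_I1 f k g r" and r: "0 < r 1" "0 < r 2"
  shows "no_stretch_on r"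
  unfolding no_stretch_on_def
proof (intro ballI allI impI notI)
  fix w l assume w: "w \<in> K" and l: "1 \<le> l" and one: "norm_gauge r w = 1" and eq: "T w = l *\<^sub>R w"
  have n: "norm (fst w) \<le> r 1" "norm (snd w) \<le> r 2"
    using one r by (auto simp: norm_gauge_def max_def divide_simps split: if_splits)
  have box: "apply_bcontfun (fst w) s \<in> {- r 1..r 1}" "apply_bcontfun (snd w) s \<in> {- r 2..r 2}" for s
    using abs_bcontfun_le_norm[of "fst w" s] abs_bcontfun_le_norm[of "snd w" s] n by auto
  obtain \<mu>1 where \<mu>1: "\<mu>1 < m_const (k 1) (g 1)"
    "\<And>t u v. t \<in> {0..1} \<Longrightarrow> u \<in> {- r 1..r 1} \<Longrightarrow> v \<in> {- r 2..r 2} \<Longrightarrow> f 1 t u v \<le> \<mu>1 * r 1"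
    using I1 r by (auto simp: cond_I1_def intro: sup_on_box_less[of "f 1" "r 1"])
  obtain \<mu>2 where \<mu>2: "\<mu>2 < m_const (k 2) (g 2)"
    "\<And>t u v. t \<in> {0..1} \<Longrightarrow> u \<in> {- r 1..r 1} \<Longrightarrow> v \<in> {- r 2..r 2} \<Longrightarrow> f 2 t u v \<le> \<mu>2 * r 2"
    using I1 r by (auto simp: cond_I1_def intro: sup_on_box_less[of "f 2" "r 2"])
  have "norm (fst (T w)) < r 1" unfolding T_def fst_conv
    by (rule H1.norm_kernel_bcont_less[OF r(1) \<mu>1(1)]) (rule \<mu>1(2)[OF _ box])
  moreover have "norm (snd (T w)) < r 2" unfolding T_def snd_conv
    by (rule H2.norm_kernel_bcont_less[OF r(2) \<mu>2(1)]) (rule \<mu>2(2)[OF _ box])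
  moreover have "norm x \<le> norm (l *\<^sub>R x)" for x :: "real \<Rightarrow>\<^sub>C real"
    using l mult_right_mono[of 1 l "norm x"] by simp
  ultimately have "norm (fst w) < r 1" "norm (snd w) < r 2"
    unfolding eq by (auto intro: le_less_trans)
  then show False using one r by (auto simp: norm_gauge_def max_def divide_simps split: if_splits)
qed

text \<open>
  On \<open>min_gauge \<rho> = 1\<close> the minima are at most \<open>\<rho> i\<close>, so by the cone inequality the norms are at
  most \<open>\<rho> i / c i\<close>: the values lie in the boxes of the conditions \<open>I\<^sup>0\<close>.
\<close>

lemma min_gauge_box:
  assumes w: "w \<in> K" and \<rho>: "0 < \<rho> 1" "0 < \<rho> 2" and one: "min_gauge \<rho> w = 1"
  shows "H1.interval_min (fst w) \<le> \<rho> 1" "H2.interval_min (snd w) \<le> \<rho> 2"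
    and "apply_bcontfun (fst w) s \<in> {-(\<rho> 1 / c 1)..\<rho> 1 / c 1}"
    and "apply_bcontfun (snd w) s \<in> {-(\<rho> 2 / c 2)..\<rho> 2 / c 2}"
    and "s \<in> {a 1..b 1} \<Longrightarrow> apply_bcontfun (fst w) s \<in> {H1.interval_min (fst w)..\<rho> 1 / c 1}"
    and "s \<in> {a 2..b 2} \<Longrightarrow> apply_bcontfun (snd w) s \<in> {H2.interval_min (snd w)..\<rho> 2 / c 2}"
proof -
  have "H1.interval_min (fst w) / \<rho> 1 \<le> 1" "H2.interval_min (snd w) / \<rho> 2 \<le> 1"
    using one by (auto simp: min_gauge_def)
  then show lows: "H1.interval_min (fst w) \<le> \<rho> 1" "H2.interval_min (snd w) \<le> \<rho> 2"
    using \<rho> by (simp_all add: pos_divide_le_eq)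
  have "c 1 * norm (fst w) \<le> \<rho> 1" "c 2 * norm (snd w) \<le> \<rho> 2"
    using lows K_bounds[OF w] by linarith+
  then have n: "norm (fst w) \<le> \<rho> 1 / c 1" "norm (snd w) \<le> \<rho> 2 / c 2"
    using H1.c H2.c by (simp_all add: pos_le_divide_eq mult.commute)
  show u: "apply_bcontfun (fst w) s \<in> {-(\<rho> 1 / c 1)..\<rho> 1 / c 1}"
    using abs_bcontfun_le_norm[of "fst w" s] n by auto
  show v: "apply_bcontfun (snd w) s \<in> {-(\<rho> 2 / c 2)..\<rho> 2 / c 2}"
    using abs_bcontfun_le_norm[of "snd w" s] n by auto
  show "apply_bcontfun (fst w) s \<in> {H1.interval_min (fst w)..\<rho> 1 / c 1}" if "s \<in> {a 1..b 1}"
    using H1.interval_min_le[OF that, of "fst w"] u by simp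
  show "apply_bcontfun (snd w) s \<in> {H2.interval_min (snd w)..\<rho> 2 / c 2}" if "s \<in> {a 2..b 2}"
    using H2.interval_min_le[OF that, of "snd w"] v by simp
qed

text \<open>
  On \<open>min_gauge \<rho> = 1\<close> one of the two minima equals \<open>\<rho> i\<close>, and the corresponding half of \<open>I\<^sup>0\<close>
  forces it to exceed \<open>\<rho> i\<close>.
\<close>

lemma cond_I0_no_lift:
  assumes I0: "cond_I0 f k g a b c \<rho>" and \<rho>: "0 < \<rho> 1" "0 < \<rho> 2"
  shows "no_lift_on \<rho>"
  unfolding no_lift_on_def
proof (intro ballI allI impI notI)
  fix w l assume w: "w \<in> K" and l: "0 \<le> l" and one: "min_gauge \<rho> w = 1" and eq: "w = T w + l *\<^sub>R unit_pair"
  have eq1: "fst w = H1.kernel_bcont (H1.superpose (fst w) (snd w)) + l *\<^sub>R const_bcontfun 1"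
    and eq2: "snd w = H2.kernel_bcont (H2.superpose (fst w) (snd w)) + l *\<^sub>R const_bcontfun 1"
    using arg_cong[OF eq, of fst] arg_cong[OF eq, of snd]
    unfolding T_def unit_pair_def fst_add snd_add fst_scaleR snd_scaleR fst_conv snd_conv by blast+
  note box = min_gauge_box[OF w \<rho> one]
  have "H1.interval_min (fst w) / \<rho> 1 = 1 \<or> H2.interval_min (snd w) / \<rho> 2 = 1"
    using one by (auto simp: min_gauge_def max_def split: if_splits)
  then consider "H1.interval_min (fst w) = \<rho> 1" | "H2.interval_min (snd w) = \<rho> 2" using \<rho> by auto
  then show False
  proof cases
    case 1
    obtain \<mu> where \<mu>: "M_const (k 1) (g 1) (a 1) (b 1) < \<mu>"
      "\<And>t u v. t \<in> {a 1..b 1} \<Longrightarrow> u \<in> {\<rho> 1..\<rho> 1 / c 1} \<Longrightarrow> v \<in> {-(\<rho> 2 / c 2)..\<rho> 2 / c 2} \<Longrightarrow> \<mu> * \<rho> 1 \<le> f 1 t u v"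
      using I0 \<rho> by (auto simp: cond_I0_def intro: inf_on_box_greater[of _ "f 1" "\<rho> 1"])
    have "\<rho> 1 < H1.interval_min (fst w)"
      by (rule H1.interval_min_greater[OF \<rho>(1) \<mu>(1) _ l eq1]) (rule \<mu>(2)[OF _ box(5)[unfolded 1] box(4)])
    with 1 show False by simp
  next
    case 2
    obtain \<mu> where \<mu>: "M_const (k 2) (g 2) (a 2) (b 2) < \<mu>"
      "\<And>t u v. t \<in> {a 2..b 2} \<Longrightarrow> u \<in> {-(\<rho> 1 / c 1)..\<rho> 1 / c 1} \<Longrightarrow> v \<in> {\<rho> 2..\<rho> 2 / c 2} \<Longrightarrow> \<mu> * \<rho> 2 \<le> f 2 t u v"
      using I0 \<rho> by (auto simp: cond_I0_def intro: inf_on_box_greater[of _ "f 2" "\<rho> 2"])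
    have "\<rho> 2 < H2.interval_min (snd w)"
      by (rule H2.interval_min_greater[OF \<rho>(2) \<mu>(1) _ l eq2]) (rule \<mu>(2)[OF _ box(3) box(6)[unfolded 2]])
    with 2 show False by simp
  qed
qed

text \<open>
  The starred condition concerns one component only, but on the larger box it applies wherever the
  minimum of that component is at most \<open>\<rho> i\<close>, no matter which of the two minima attains its bound.
\<close>

lemma cond_I0_star_no_lift:
  assumes I0: "cond_I0_star f k g a b c \<rho>" and \<rho>: "0 < \<rho> 1" "0 < \<rho> 2"
  shows "no_lift_on \<rho>"
  unfolding no_lift_on_def
proof (intro ballI allI impI notI)
  fix w l assume w: "w \<in> K" and l: "0 \<le> l" and one: "min_gauge \<rho> w = 1" and eq: "w = T w + l *\<^sub>R unit_pair"
  have eq1: "fst w = H1.kernel_bcont (H1.superpose (fst w) (snd w)) + l *\<^sub>R const_bcontfun 1"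
    and eq2: "snd w = H2.kernel_bcont (H2.superpose (fst w) (snd w)) + l *\<^sub>R const_bcontfun 1"
    using arg_cong[OF eq, of fst] arg_cong[OF eq, of snd]
    unfolding T_def unit_pair_def fst_add snd_add fst_scaleR snd_scaleR fst_conv snd_conv by blast+
  note box = min_gauge_box[OF w \<rho> one]
  have u0: "apply_bcontfun (fst w) s \<in> {0..\<rho> 1 / c 1}" if "s \<in> {a 1..b 1}" for s
    using box(5)[OF that] K_bounds(3)[OF w] by simp
  have v0: "apply_bcontfun (snd w) s \<in> {0..\<rho> 2 / c 2}" if "s \<in> {a 2..b 2}" for s
    using box(6)[OF that] K_bounds(4)[OF w] by simp
  from I0 consider
    (1) "ereal (M_const (k 1) (g 1) (a 1) (b 1)) < inf_on_box (f 1) (\<rho> 1) {a 1..b 1} {0..\<rho> 1 / c 1} {-(\<rho> 2 / c 2)..\<rho> 2 / c 2}"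
  | (2) "ereal (M_const (k 2) (g 2) (a 2) (b 2)) < inf_on_box (f 2) (\<rho> 2) {a 2..b 2} {-(\<rho> 1 / c 1)..\<rho> 1 / c 1} {0..\<rho> 2 / c 2}"
    unfolding cond_I0_star_def by blast
  then show False
  proof cases
    case 1
    obtain \<mu> where \<mu>: "M_const (k 1) (g 1) (a 1) (b 1) < \<mu>"
      "\<And>t u v. t \<in> {a 1..b 1} \<Longrightarrow> u \<in> {0..\<rho> 1 / c 1} \<Longrightarrow> v \<in> {-(\<rho> 2 / c 2)..\<rho> 2 / c 2} \<Longrightarrow> \<mu> * \<rho> 1 \<le> f 1 t u v"
      by (rule inf_on_box_greater[OF 1 \<rho>(1)]) blast
    have "\<rho> 1 < H1.interval_min (fst w)"
      by (rule H1.interval_min_greater[OF \<rho>(1) \<mu>(1) _ l eq1]) (rule \<mu>(2)[OF _ u0 box(4)])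
    with box(1) show False by simp
  next
    case 2
    obtain \<mu> where \<mu>: "M_const (k 2) (g 2) (a 2) (b 2) < \<mu>"
      "\<And>t u v. t \<in> {a 2..b 2} \<Longrightarrow> u \<in> {-(\<rho> 1 / c 1)..\<rho> 1 / c 1} \<Longrightarrow> v \<in> {0..\<rho> 2 / c 2} \<Longrightarrow> \<mu> * \<rho> 2 \<le> f 2 t u v"
      by (rule inf_on_box_greater[OF 2 \<rho>(2)]) blast
    have "\<rho> 2 < H2.interval_min (snd w)"
      by (rule H2.interval_min_greater[OF \<rho>(2) \<mu>(1) _ l eq2]) (rule \<mu>(2)[OF _ box(3) v0])
    with box(2) show False by simp
  qed
qed


definition fixed_points :: "((real \<Rightarrow>\<^sub>C real) \<times> (real \<Rightarrow>\<^sub>C real)) set" where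
  "fixed_points = {w \<in> K. w \<noteq> 0 \<and> T w = w}"

lemma fixed_point_compression:
  assumes r: "\<forall>i\<in>{1, 2}. 0 < \<rho> i \<and> 0 < r i \<and> \<rho> i / c i < r i"
    and I: "cond_I0 f k g a b c \<rho> \<or> cond_I0_star f k g a b c \<rho>" "cond_I1 f k g r"
  shows "\<exists>w\<in>fixed_points. 1 < min_gauge \<rho> w \<and> norm_gauge r w < 1"
proof -
  have pos: "0 < \<rho> 1" "0 < \<rho> 2" "0 < r 1" "0 < r 2" using r by blast+
  have "no_lift_on \<rho>" using I(1) cond_I0_no_lift cond_I0_star_no_lift pos(1,2) by blast
  then have "\<exists>w\<in>K. 1 < min_gauge \<rho> w \<and> norm_gauge r w < 1 \<and> T w = w"
    by (intro compression_solution cond_I1_no_stretch[OF I(2) pos(3,4)]) (use r in \<open>auto intro: less_imp_le\<close>)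
  then obtain w where w: "w \<in> K" "1 < min_gauge \<rho> w" "norm_gauge r w < 1" "T w = w" by blast
  have "min_gauge \<rho> 0 = 0" using min_gauge_scale[of 0 \<rho> 0] by simp
  with w(2) have "w \<noteq> 0" by auto
  with w show ?thesis unfolding fixed_points_def by blast
qed

lemma fixed_point_expansion:
  assumes r: "\<forall>i\<in>{1, 2}. 0 < \<rho> i \<and> 0 < r i \<and> \<rho> i < r i"
    and I: "cond_I1 f k g \<rho>" "cond_I0 f k g a b c r"
  shows "\<exists>w\<in>fixed_points. 1 < norm_gauge \<rho> w \<and> min_gauge r w < 1"
proof -
  have pos: "0 < \<rho> 1" "0 < \<rho> 2" "0 < r 1" "0 < r 2" using r by blast+
  have "\<exists>w\<in>K. 1 < norm_gauge \<rho> w \<and> min_gauge r w < 1 \<and> T w = w"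
    by (intro expansion_solution cond_I1_no_stretch[OF I(1) pos(1,2)] cond_I0_no_lift[OF I(2) pos(3,4)])
      (use r in \<open>auto intro: less_imp_le\<close>)
  then obtain w where w: "w \<in> K" "1 < norm_gauge \<rho> w" "min_gauge r w < 1" "T w = w" by blast
  have "norm_gauge \<rho> 0 = 0" using norm_gauge_scale[of 0 \<rho> 0] by simp
  with w(2) have "w \<noteq> 0" by auto
  with w show ?thesis unfolding fixed_points_def by blast
qed

definition restrict_pair :: "(real \<Rightarrow>\<^sub>C real) \<times> (real \<Rightarrow>\<^sub>C real) \<Rightarrow> (real \<Rightarrow> real) \<times> (real \<Rightarrow> real)" where
  "restrict_pair w = (restrict (apply_bcontfun (fst w)) {0..1}, restrict (apply_bcontfun (snd w)) {0..1})"

lemma restrict_pair_inj_on: "inj_on restrict_pair K"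
proof (rule inj_onI)
  fix x y assume K: "x \<in> K" "y \<in> K" and eq: "restrict_pair x = restrict_pair y"
  have "fst x = fst y"
    by (rule inj_onD[OF H1.restrict_inj_on_cone]) (use K eq in \<open>auto simp: K_def restrict_pair_def\<close>)
  moreover have "snd x = snd y"
    by (rule inj_onD[OF H2.restrict_inj_on_cone]) (use K eq in \<open>auto simp: K_def restrict_pair_def\<close>)
  ultimately show "x = y" by (rule prod_eqI)
qed

text \<open>
  The passage from functions that are constant outside \<open>[0,1]\<close> to functions that are undefined
  there.
\<close>

lemma restrict_pair_solution:
  assumes "w \<in> fixed_points"
  shows "restrict_pair w \<in> nontrivial_solutions f k g a b c"
proof -
  obtain u v where w: "w = (u, v)" by (cases w)
  have K: "u \<in> H1.cone" "v \<in> H2.cone" and nz: "w \<noteq> 0"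
    and fix1: "u = H1.kernel_bcont (H1.superpose u v)" and fix2: "v = H2.kernel_bcont (H2.superpose u v)"
    using assms by (auto simp: fixed_points_def K_def T_def w)
  obtain B1 where B1: "H1.admissible B1 (H1.superpose u v)" by (rule H1.superpose_admissible_ex)
  obtain B2 where B2: "H2.admissible B2 (H2.superpose u v)" by (rule H2.superpose_admissible_ex)
  let ?u = "restrict (apply_bcontfun u) {0..1}" and ?v = "restrict (apply_bcontfun v) {0..1}"
  have sol: "is_solution f k g ?u ?v"
    unfolding is_solution_def
  proof (intro ballI conjI)
    fix t :: real assume t: "t \<in> {0..1}"
    have "?u t = apply_bcontfun (H1.kernel_bcont (H1.superpose u v)) t" using t fix1 by simp
    also have "\<dots> = H1.kernel_op (H1.superpose u v) t" by (simp only: H1.kernel_bcont_apply[OF B1] clamp01_id[OF t])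
    finally show "?u t = (LINT s|leb01. k 1 t s * g 1 s * f 1 s (?u s) (?v s))" by (simp only: H1.kernel_op_restrict)
    have "?v t = apply_bcontfun (H2.kernel_bcont (H2.superpose u v)) t" using t fix2 by simp
    also have "\<dots> = H2.kernel_op (H2.superpose u v) t" by (simp only: H2.kernel_bcont_apply[OF B2] clamp01_id[OF t])
    finally show "?v t = (LINT s|leb01. k 2 t s * g 2 s * f 2 s (?u s) (?v s))" by (simp only: H2.kernel_op_restrict)
  qed
  have "pair_norm (?u, ?v) = max (norm u) (norm v)"
    by (simp only: pair_norm_def fst_conv snd_conv H1.supnorm01_restrict[OF K(1)] H2.supnorm01_restrict[OF K(2)])
  moreover have "u \<noteq> 0 \<or> v \<noteq> 0" using nz by (simp add: w prod_eq_iff)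
  then have "0 < max (norm u) (norm v)" by (auto simp: less_max_iff_disj)
  ultimately have "pair_norm (?u, ?v) \<noteq> 0" by linarith
  moreover have "(?u, ?v) \<in> K_cone a b c"
    unfolding K_cone_def using H1.restrict_in_K_tilde[OF K(1)] H2.restrict_in_K_tilde[OF K(2)] by (rule SigmaI)
  ultimately show ?thesis using sol by (simp add: nontrivial_solutions_def restrict_pair_def w)
qed

lemma has_at_least_solutions:
  assumes "finite S" "S \<subseteq> fixed_points"
  shows "has_at_least (card S) (nontrivial_solutions f k g a b c)"
  unfolding has_at_least_def
proof (intro exI conjI)
  show "restrict_pair ` S \<subseteq> nontrivial_solutions f k g a b c"
    using restrict_pair_solution assms(2) by blast
  show "finite (restrict_pair ` S)" using assms(1) by simp
  show "card (restrict_pair ` S) = card S"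
    by (rule card_image, rule inj_on_subset[OF restrict_pair_inj_on])
      (use assms(2) in \<open>auto simp: fixed_points_def\<close>)
qed

lemma one_solution: "w \<in> fixed_points \<Longrightarrow> has_at_least 1 (nontrivial_solutions f k g a b c)"
  using has_at_least_solutions[of "{w}"] by simp

lemma two_solutions:
  assumes "w \<in> fixed_points" "w' \<in> fixed_points" "w \<noteq> w'"
  shows "has_at_least 2 (nontrivial_solutions f k g a b c)"
proof -
  have "card {w, w'} = 2" using assms(3) by simp
  with has_at_least_solutions[of "{w, w'}"] assms show ?thesis by simp
qed

lemma three_solutions:
  assumes "w \<in> fixed_points" "w' \<in> fixed_points" "w'' \<in> fixed_points" "w \<noteq> w'" "w' \<noteq> w''" "w \<noteq> w''"
  shows "has_at_least 3 (nontrivial_solutions f k g a b c)"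
proof -
  have "card {w, w', w''} = 3" using assms(4-6) by simp
  with has_at_least_solutions[of "{w, w', w''}"] assms show ?thesis by simp
qed

lemma min_gauge_less_one:
  assumes "w \<in> fixed_points" "\<forall>i\<in>{1, 2}. 0 < r i \<and> r i < s i" "norm_gauge r w < 1"
  shows "min_gauge s w < 1"
proof -
  have "min_gauge s w \<le> norm_gauge r w"
    by (rule min_gauge_le_norm_gauge) (use assms(1,2) in \<open>auto simp: fixed_points_def\<close>)
  with assms(3) show ?thesis by simp
qed

lemma norm_gauge_less_one:
  assumes "w \<in> fixed_points" "\<forall>i\<in>{1, 2}. 0 < r i \<and> r i / c i < s i" "min_gauge r w < 1"
  shows "norm_gauge s w < 1"
proof -
  have "norm_gauge s w \<le> min_gauge r w"
    by (rule norm_gauge_le_min_gauge) (use assms(1,2) in \<open>auto simp: fixed_points_def\<close>)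
  with assms(3) show ?thesis by simp
qed

lemma solutions_I0_I1:
  assumes "\<forall>i\<in>{1, 2}. 0 < \<rho> i \<and> 0 < r i \<and> \<rho> i / c i < r i"
    and "cond_I0 f k g a b c \<rho> \<or> cond_I0_star f k g a b c \<rho>" "cond_I1 f k g r"
  shows "has_at_least 1 (nontrivial_solutions f k g a b c)"
  using fixed_point_compression[OF assms] one_solution by blast

lemma solutions_I1_I0:
  assumes "\<forall>i\<in>{1, 2}. 0 < \<rho> i \<and> 0 < r i \<and> \<rho> i < r i" "cond_I1 f k g \<rho>" "cond_I0 f k g a b c r"
  shows "has_at_least 1 (nontrivial_solutions f k g a b c)"
  using fixed_point_expansion[OF assms] one_solution by blast

lemma solutions_I0_I1_I0:
  assumes r: "\<forall>i\<in>{1, 2}. 0 < \<rho> i \<and> 0 < r i \<and> 0 < s i \<and> \<rho> i / c i < r i \<and> r i < s i"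
    and I: "cond_I0 f k g a b c \<rho> \<or> cond_I0_star f k g a b c \<rho>" "cond_I1 f k g r" "cond_I0 f k g a b c s"
  shows "has_at_least 2 (nontrivial_solutions f k g a b c)"
proof -
  obtain w where w: "w \<in> fixed_points" "norm_gauge r w < 1"
    using fixed_point_compression[OF _ I(1,2)] r by blast
  obtain w' where w': "w' \<in> fixed_points" "1 < norm_gauge r w'"
    using fixed_point_expansion[OF _ I(2,3)] r by blast
  have "w \<noteq> w'" using w(2) w'(2) by auto
  with w(1) w'(1) show ?thesis by (rule two_solutions)
qed

lemma solutions_I1_I0_I1:
  assumes r: "\<forall>i\<in>{1, 2}. 0 < \<rho> i \<and> 0 < r i \<and> 0 < s i \<and> \<rho> i < r i \<and> r i / c i < s i"
    and I: "cond_I1 f k g \<rho>" "cond_I0 f k g a b c r" "cond_I1 f k g s"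
  shows "has_at_least 2 (nontrivial_solutions f k g a b c)"
proof -
  obtain w where w: "w \<in> fixed_points" "min_gauge r w < 1"
    using fixed_point_expansion[OF _ I(1,2)] r by blast
  obtain w' where w': "w' \<in> fixed_points" "1 < min_gauge r w'"
    using fixed_point_compression[OF _ disjI1[OF I(2)] I(3)] r by blast
  have "w \<noteq> w'" using w(2) w'(2) by auto
  with w(1) w'(1) show ?thesis by (rule two_solutions)
qed

text \<open>
  Consecutive annuli are separated by the gauge of their common boundary. The first and the
  third annulus are separated by the gauge of the second common boundary, because the gauge of the first
  one dominates it.
\<close>

lemma solutions_I0_I1_I0_I1:
  assumes r: "\<forall>i\<in>{1, 2}. 0 < \<rho> i \<and> 0 < r i \<and> 0 < s i \<and> 0 < \<sigma> i \<and> \<rho> i / c i < r i \<and> r i < s i \<and> s i / c i < \<sigma> i"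
    and I: "cond_I0 f k g a b c \<rho> \<or> cond_I0_star f k g a b c \<rho>" "cond_I1 f k g r" "cond_I0 f k g a b c s" "cond_I1 f k g \<sigma>"
  shows "has_at_least 3 (nontrivial_solutions f k g a b c)"
proof -
  obtain w where w: "w \<in> fixed_points" "norm_gauge r w < 1"
    using fixed_point_compression[OF _ I(1,2)] r by blast
  obtain w' where w': "w' \<in> fixed_points" "1 < norm_gauge r w'" "min_gauge s w' < 1"
    using fixed_point_expansion[OF _ I(2,3)] r by blast
  obtain w'' where w'': "w'' \<in> fixed_points" "1 < min_gauge s w''"
    using fixed_point_compression[OF _ disjI1[OF I(3)] I(4)] r by blast
  have "min_gauge s w < 1" by (rule min_gauge_less_one[OF w(1) _ w(2)]) (use r in blast)
  then have "w \<noteq> w'" "w' \<noteq> w''" "w \<noteq> w''" using w(2) w'(2,3) w''(2) by auto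
  with w(1) w'(1) w''(1) show ?thesis by (rule three_solutions)
qed

lemma solutions_I1_I0_I1_I0:
  assumes r: "\<forall>i\<in>{1, 2}. 0 < \<rho> i \<and> 0 < r i \<and> 0 < s i \<and> 0 < \<sigma> i \<and> \<rho> i < r i \<and> r i / c i < s i \<and> s i < \<sigma> i"
    and I: "cond_I1 f k g \<rho>" "cond_I0 f k g a b c r" "cond_I1 f k g s" "cond_I0 f k g a b c \<sigma>"
  shows "has_at_least 3 (nontrivial_solutions f k g a b c)"
proof -
  obtain w where w: "w \<in> fixed_points" "min_gauge r w < 1"
    using fixed_point_expansion[OF _ I(1,2)] r by blast
  obtain w' where w': "w' \<in> fixed_points" "1 < min_gauge r w'" "norm_gauge s w' < 1"
    using fixed_point_compression[OF _ disjI1[OF I(2)] I(3)] r by blast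
  obtain w'' where w'': "w'' \<in> fixed_points" "1 < norm_gauge s w''"
    using fixed_point_expansion[OF _ I(3,4)] r by blast
  have "norm_gauge s w < 1" by (rule norm_gauge_less_one[OF w(1) _ w(2)]) (use r in blast)
  then have "w \<noteq> w'" "w' \<noteq> w''" "w \<noteq> w''" using w(2) w'(2,3) w''(2) by auto
  with w(1) w'(1) w''(1) show ?thesis by (rule three_solutions)
qed

end

theorem theorem3p5:
  fixes f :: "nat \<Rightarrow> real \<Rightarrow> real \<Rightarrow> real \<Rightarrow> real"
    and k :: "nat \<Rightarrow> real \<Rightarrow> real \<Rightarrow> real"
    and g \<Phi> :: "nat \<Rightarrow> real \<Rightarrow> real"
    and a b c :: "nat \<Rightarrow> real"
  assumes "\<forall>i\<in>{1, 2}. standing_assumptions (f i) (k i) (g i) (\<Phi> i) (a i) (b i) (c i)"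
  shows
    "((\<exists>\<rho> r. (\<forall>i\<in>{1, 2}. 0 < \<rho> i \<and> 0 < r i \<and> \<rho> i / c i < r i) \<and>
         (cond_I0 f k g a b c \<rho> \<or> cond_I0_star f k g a b c \<rho>) \<and> cond_I1 f k g r)
      \<or>
      (\<exists>\<rho> r. (\<forall>i\<in>{1, 2}. 0 < \<rho> i \<and> 0 < r i \<and> \<rho> i < r i) \<and>
         cond_I1 f k g \<rho> \<and> cond_I0 f k g a b c r)
      \<longrightarrow> has_at_least 1 (nontrivial_solutions f k g a b c))
     \<and>
     ((\<exists>\<rho> r s. (\<forall>i\<in>{1, 2}. 0 < \<rho> i \<and> 0 < r i \<and> 0 < s i \<and> \<rho> i / c i < r i \<and> r i < s i) \<and>
         (cond_I0 f k g a b c \<rho> \<or> cond_I0_star f k g a b c \<rho>) \<and> cond_I1 f k g r \<and>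
         cond_I0 f k g a b c s)
      \<or>
      (\<exists>\<rho> r s. (\<forall>i\<in>{1, 2}. 0 < \<rho> i \<and> 0 < r i \<and> 0 < s i \<and> \<rho> i < r i \<and> r i / c i < s i) \<and>
         cond_I1 f k g \<rho> \<and> cond_I0 f k g a b c r \<and> cond_I1 f k g s)
      \<longrightarrow> has_at_least 2 (nontrivial_solutions f k g a b c))
     \<and>
     ((\<exists>\<rho> r s \<sigma>. (\<forall>i\<in>{1, 2}. 0 < \<rho> i \<and> 0 < r i \<and> 0 < s i \<and> 0 < \<sigma> i \<and>
                      \<rho> i / c i < r i \<and> r i < s i \<and> s i / c i < \<sigma> i) \<and>
         (cond_I0 f k g a b c \<rho> \<or> cond_I0_star f k g a b c \<rho>) \<and> cond_I1 f k g r \<and>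
         cond_I0 f k g a b c s \<and> cond_I1 f k g \<sigma>)
      \<or>
      (\<exists>\<rho> r s \<sigma>. (\<forall>i\<in>{1, 2}. 0 < \<rho> i \<and> 0 < r i \<and> 0 < s i \<and> 0 < \<sigma> i \<and>
                      \<rho> i < r i \<and> r i / c i < s i \<and> s i < \<sigma> i) \<and>
         cond_I1 f k g \<rho> \<and> cond_I0 f k g a b c r \<and> cond_I1 f k g s \<and>
         cond_I0 f k g a b c \<sigma>)
      \<longrightarrow> has_at_least 3 (nontrivial_solutions f k g a b c))"
proof -
  interpret hammerstein_system f k g \<Phi> a b c
    by unfold_locales (rule assms)
  show ?thesis
  proof (intro conjI impI, goal_cases)
    case 1
    then show ?case
      by (rule disjE) (elim exE conjE, erule (2) solutions_I0_I1, elim exE conjE, erule (2) solutions_I1_I0)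
  next
    case 2
    then show ?case
      by (rule disjE) (elim exE conjE, erule (3) solutions_I0_I1_I0, elim exE conjE, erule (3) solutions_I1_I0_I1)
  next
    case 3
    then show ?case
      by (rule disjE) (elim exE conjE, erule (4) solutions_I0_I1_I0_I1, elim exE conjE, erule (4) solutions_I1_I0_I1_I0)
  qed
qed

end
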